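(* Let $W$ be a compact closed oriented $3$-manifold, $\rho$ a flat principal $PSL(2,\mathbb{C})$-bundle over $W$, and $\mathcal{T}_{\mathcal{I}}=(T,b,w)$ an $\mathcal{I}$-triangulation for $(W,\rho)$. For any edge $e\in E(T)$ we have $$\prod_{a\in\epsilon_T^{-1}(e)}w(a)^{*}=1,$$ where $*=\pm1$ is the index $*_b$ of the abstract tetrahedron $\Delta_i$ that contains $a$.
   Context: A triangulation $T$ of $W$ is a singular triangulation: a finite family of oriented abstract tetrahedra $\Delta_i$ (with the orientation of $W$) with identifications of pairs of distinct abstract $2$-faces, with quotient $W$; self-adjacencies and multiple adjacencies are allowed. $E(T)$ is the set of edges of $T$ (after identification), $E_\Delta(T)$ the set of all edges of the abstract tetrahedra, $\epsilon_T:E_\Delta(T)\to E(T)$ the identification map. $T$ is quasi-regular if every edge of $T$ has two distinct endpoints. A branching $b$ of $T$ is a choice of orientation for each edge of $T$ which on every abstract tetrahedron comes from a total ordering $v_0,v_1,v_2,v_3$ of its vertices, each edge pointing from its smaller to its larger endpoint. Put $e_0=[v_0,v_1]$, $e_1=[v_1,v_2]$, $e_2=[v_0,v_2]$, and let $e'_j$ be the edge opposite to $e_j$. The index $*_b$ of the tetrahedron is $1$ if the orientation given by the ordered triple $([v_0,v_1],[v_0,v_2],[v_0,v_3])$ agrees with that of $W$, and $-1$ otherwise. A $PSL(2,\mathbb{C})$-valued $1$-cocycle $z$ on $T$ assigns $z(e)\in PSL(2,\mathbb{C})$ to each oriented edge, with $z(-e)=z(e)^{-1}$ and $z([x,y])z([y,t])=z([x,t])$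 on each $2$-face with vertices $x,y,t$. Two cocycles are equivalent if they differ by $z'(e)=\lambda(v)^{-1}z(e)\lambda(v')$ ($e$ from $v$ to $v'$) for some $PSL(2,\mathbb{C})$-valued function $\lambda$ on the vertices; equivalence classes correspond to isomorphism classes of flat principal $PSL(2,\mathbb{C})$-bundles on $W$. $PSL(2,\mathbb{C})$ acts on $\mathbb{CP}^1$ by Moebius transformations. On a branched tetrahedron with cocycle $z$ write $z_j=z(e_j)$, $z'_j=z(e'_j)$. It is idealizable if $u_0=0$, $u_1=z_0(0)$, $u_2=z_0z_1(0)$, $u_3=z_0z_1z'_0(0)$ are $4$ distinct points of $\mathbb{C}$. Then put $p_0=u_1(u_3-u_2)$, $p_1=(u_2-u_1)u_3$, $p_2=-u_2(u_3-u_1)$, $w_j=-p_{j+1}/p_{j+2}$ (indices mod $3$), and $w(e_j)=w(e'_j)=w_j\in\mathbb{C}\setminus\{0,1\}$. A $\mathcal{D}$-triangulation for $(W,\rho)$ is $\mathcal{T}=(T,b,z)$ with $T$ quasi-regular, $b$ a branching, $z$ a $1$-cocycle representing $\rho$ such that all abstract tetrahedra are idealizable. Its idealization $\mathcal{T}_{\mathcal{I}}=(T,b,w)$ is called an $\mathcal{I}$-triangulation for $(W,\rho)$. *)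

theory Defs
  imports "HOL-Homology.Homology" "HOL-Analysis.Analysis"
begin

section \<open>The group \<open>PSL(2,\<complex>)\<close> and its action on \<open>\<complex>P\<^sup>1\<close>\<close>

definition SL2C :: "(complex^2^2) monoid" where
  "SL2C = \<lparr>carrier = {A. det A = 1}, monoid.mult = (**), one = mat 1\<rparr>"

definition PSL2C :: "(complex^2^2) set monoid" where
  "PSL2C = SL2C Mod {mat 1, - mat 1}"

datatype cp1 = Fin_pt (coord: complex) | Infty

fun moebius_mat :: "complex^2^2 \<Rightarrow> cp1 \<Rightarrow> cp1" where
  "moebius_mat A (Fin_pt x) =
     (if A$2$1 * x + A$2$2 = 0 then Infty
      else Fin_pt ((A$1$1 * x + A$1$2) / (A$2$1 * x + A$2$2)))"
| "moebius_mat A Infty = (if A$2$1 = 0 then Infty else Fin_pt (A$1$1 / A$2$1))"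

text \<open>Both representatives \<open>A\<close>, \<open>-A\<close> of an element of \<open>PSL2C\<close> give the same point, so the image
  below is a singleton.\<close>

definition psl_act :: "(complex^2^2) set \<Rightarrow> cp1 \<Rightarrow> cp1" where
  "psl_act g x = the_elem ((\<lambda>A. moebius_mat A x) ` g)"


section \<open>Closed oriented 3-manifolds\<close>

definition closed_3manifold :: "'w topology \<Rightarrow> bool" where
  "closed_3manifold W \<longleftrightarrow>
     compact_space W \<and> Hausdorff_space W \<and> second_countable W \<and>
     (\<forall>x\<in>topspace W. \<exists>U. openin W U \<and> x \<in> U \<and>
        (subtopology W U) homeomorphic_space (Euclidean_space 3))"

text \<open>An orientation is a choice, at each point \<open>x\<close>, of a generator of \<open>H\<^sub>3(W, W - x)\<close>, such that
  locally all the chosen generators are restrictions of one class in \<open>H\<^sub>3(W, W - U)\<close>.\<close>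

definition orientation :: "'w topology \<Rightarrow> ('w \<Rightarrow> 'w chain set) \<Rightarrow> bool" where
  "orientation W ori \<longleftrightarrow>
     (\<forall>x\<in>topspace W.
        ori x \<in> carrier (relative_homology_group 3 W (topspace W - {x})) \<and>
        generate (relative_homology_group 3 W (topspace W - {x})) {ori x}
          = carrier (relative_homology_group 3 W (topspace W - {x}))) \<and>
     (\<forall>x\<in>topspace W. \<exists>U c. openin W U \<and> x \<in> U \<and>
        c \<in> carrier (relative_homology_group 3 W (topspace W - U)) \<and>
        (\<forall>y\<in>U. hom_induced 3 W (topspace W - U) W (topspace W - {y}) id c = ori y))"

definition closed_oriented_3manifold :: "'w topology \<Rightarrow> ('w \<Rightarrow> 'w chain set) \<Rightarrow> bool" where
  "closed_oriented_3manifold W ori \<longleftrightarrow> closed_3manifold W \<and> orientation W ori"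


section \<open>Flat principal bundles\<close>

record ('p, 'w, 'g) gbundle =
  total :: "'p topology"
  proj :: "'p \<Rightarrow> 'w"
  ract :: "'p \<Rightarrow> 'g \<Rightarrow> 'p"

text \<open>A flat principal \<open>G\<close>-bundle is a principal bundle with locally constant transition functions,
  i.e. a principal bundle whose structure group is \<open>G\<close> with the discrete topology. The topology of
  \<open>total\<close> is accordingly the leaf topology of the flat connection.\<close>

definition flat_principal_bundle ::
    "('g, 'm) monoid_scheme \<Rightarrow> 'w topology \<Rightarrow> ('p, 'w, 'g) gbundle \<Rightarrow> bool" where
  "flat_principal_bundle G W R \<longleftrightarrow>
     (\<forall>x\<in>topspace (total R).
        proj R x \<in> topspace W \<and> ract R x \<one>\<^bsub>G\<^esub> = x \<and>
        (\<forall>g\<in>carrier G. ract R x g \<in> topspace (total R) \<and> proj R (ract R x g) = proj R x \<and>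
           (\<forall>h\<in>carrier G. ract R (ract R x g) h = ract R x (g \<otimes>\<^bsub>G\<^esub> h)))) \<and>
     (\<forall>x\<in>topspace W. \<exists>U \<phi>. openin W U \<and> x \<in> U \<and>
        homeomorphic_map (prod_topology (subtopology W U) (discrete_topology (carrier G)))
          (subtopology (total R) {y \<in> topspace (total R). proj R y \<in> U}) \<phi> \<and>
        (\<forall>y\<in>U. \<forall>g\<in>carrier G. proj R (\<phi> (y, g)) = y \<and>
           (\<forall>h\<in>carrier G. \<phi> (y, g \<otimes>\<^bsub>G\<^esub> h) = ract R (\<phi> (y, g)) h)))"


section \<open>Singular triangulations\<close>

text \<open>Each abstract tetrahedron \<open>i\<close> is a copy of \<open>standard_simplex 3\<close>, with vertices
  labelled \<open>0, 1, 2, 3\<close>; its face \<open>(i, k)\<close> is the one opposite to the vertex \<open>k\<close>.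
  \<^item> \<open>tor i = 1\<close> or \<open>-1\<close>: the orientation of the tetrahedron \<open>i\<close> is that of the vertex ordering
    \<open>0, 1, 2, 3\<close>, respectively the opposite one;
  \<^item> \<open>mate\<close> is the pairing of the abstract faces, and \<open>glue (i, k)\<close> is the identification of the
    vertices of the face \<open>(i, k)\<close> with those of its mate;
  \<^item> \<open>quo\<close> is the quotient map from the disjoint union of the tetrahedra.\<close>

record ('i, 'w) triang =
  tets :: "'i set"
  tor :: "'i \<Rightarrow> int"
  mate :: "'i \<times> nat \<Rightarrow> 'i \<times> nat"
  glue :: "'i \<times> nat \<Rightarrow> nat \<Rightarrow> nat"
  quo :: "'i \<times> (nat \<Rightarrow> real) \<Rightarrow> 'w"

definition tet_vertex :: "nat \<Rightarrow> nat \<Rightarrow> real" where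
  "tet_vertex v = (\<lambda>j. if j = v then 1 else 0)"

definition abs_faces :: "('i, 'w) triang \<Rightarrow> ('i \<times> nat) set" where
  "abs_faces T = tets T \<times> {..3}"

definition face_pairing :: "('i, 'w) triang \<Rightarrow> bool" where
  "face_pairing T \<longleftrightarrow>
     (\<forall>f\<in>abs_faces T. mate T f \<in> abs_faces T \<and> mate T f \<noteq> f \<and> mate T (mate T f) = f \<and>
        bij_betw (glue T f) ({..3} - {snd f}) ({..3} - {snd (mate T f)}) \<and>
        (\<forall>v\<in>{..3} - {snd f}. glue T (mate T f) (glue T f v) = v))"

definition point_id ::
    "('i, 'w) triang \<Rightarrow> 'i \<times> (nat \<Rightarrow> real) \<Rightarrow> 'i \<times> (nat \<Rightarrow> real) \<Rightarrow> bool" where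
  "point_id T s t \<longleftrightarrow>
     snd s \<in> standard_simplex 3 \<and> snd t \<in> standard_simplex 3 \<and>
     (\<exists>k l. (fst s, k) \<in> abs_faces T \<and> mate T (fst s, k) = (fst t, l) \<and>
        snd s k = 0 \<and> snd t l = 0 \<and>
        (\<forall>v\<in>{..3} - {k}. snd t (glue T (fst s, k) v) = snd s v))"

text \<open>The singular 3-simplex of \<open>W\<close> carried by the tetrahedron \<open>i\<close> with its vertices in the
  order \<open>s 0, s 1, s 2, s 3\<close>.\<close>

definition tet_simplex :: "('i, 'w) triang \<Rightarrow> 'i \<Rightarrow> (nat \<Rightarrow> nat) \<Rightarrow> (nat \<Rightarrow> real) \<Rightarrow> 'w" where
  "tet_simplex T i s =
     simplex_map 3 (\<lambda>x. quo T (i, x)) (oriented_simplex 3 (\<lambda>m. tet_vertex (s m)))"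

definition local_class :: "'w topology \<Rightarrow> ((nat \<Rightarrow> real) \<Rightarrow> 'w) \<Rightarrow> (nat \<Rightarrow> real) \<Rightarrow> 'w chain set" where
  "local_class W f x = homologous_rel_set 3 W (topspace W - {f x}) (frag_of f)"

definition open_tet :: "(nat \<Rightarrow> real) set" where
  "open_tet = {x \<in> standard_simplex 3. \<forall>j\<le>3. 0 < x j}"

definition triangulation ::
    "'w topology \<Rightarrow> ('w \<Rightarrow> 'w chain set) \<Rightarrow> ('i, 'w) triang \<Rightarrow> bool" where
  "triangulation W ori T \<longleftrightarrow>
     finite (tets T) \<and> face_pairing T \<and>
     quotient_map
       (sum_topology (\<lambda>_. subtopology (powertop_real UNIV) (standard_simplex 3)) (tets T)) W (quo T) \<and>
     (\<forall>s\<in>tets T \<times> standard_simplex 3. \<forall>t\<in>tets T \<times> standard_simplex 3.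
        quo T s = quo T t \<longleftrightarrow> equivclp (point_id T) s t) \<and>
     (\<forall>i\<in>tets T. tor T i \<in> {1, -1} \<and>
        (\<forall>x\<in>open_tet.
           local_class W (tet_simplex T i id) x
             [^]\<^bsub>relative_homology_group 3 W (topspace W - {tet_simplex T i id x})\<^esub> tor T i
           = ori (tet_simplex T i id x)))"


section \<open>Edges of a triangulation\<close>

text \<open>\<open>(i, {u, v})\<close> is the abstract edge of the tetrahedron \<open>i\<close> with endpoints \<open>u\<close>, \<open>v\<close>, and
  \<open>(i, u, v)\<close> is the same edge oriented from \<open>u\<close> to \<open>v\<close>. The edges and oriented edges of \<open>T\<close>
  are the equivalence classes under the identifications.\<close>

definition abs_edges :: "('i, 'w) triang \<Rightarrow> ('i \<times> nat set) set" where
  "abs_edges T = {(i, {u, v}) |i u v. i \<in> tets T \<and> u \<le> 3 \<and> v \<le> 3 \<and> u \<noteq> v}"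

definition edge_id :: "('i, 'w) triang \<Rightarrow> 'i \<times> nat set \<Rightarrow> 'i \<times> nat set \<Rightarrow> bool" where
  "edge_id T a c \<longleftrightarrow> a \<in> abs_edges T \<and>
     (\<exists>k\<le>3. k \<notin> snd a \<and> c = (fst (mate T (fst a, k)), glue T (fst a, k) ` snd a))"

definition edge_map :: "('i, 'w) triang \<Rightarrow> 'i \<times> nat set \<Rightarrow> ('i \<times> nat set) set" where
  "edge_map T a = {c. equivclp (edge_id T) a c}"

definition edges :: "('i, 'w) triang \<Rightarrow> ('i \<times> nat set) set set" where
  "edges T = edge_map T ` abs_edges T"

definition abs_oedges :: "('i, 'w) triang \<Rightarrow> ('i \<times> nat \<times> nat) set" where
  "abs_oedges T = {(i, u, v). i \<in> tets T \<and> u \<le> 3 \<and> v \<le> 3 \<and> u \<noteq> v}"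

definition oedge_id :: "('i, 'w) triang \<Rightarrow> 'i \<times> nat \<times> nat \<Rightarrow> 'i \<times> nat \<times> nat \<Rightarrow> bool" where
  "oedge_id T a c \<longleftrightarrow> a \<in> abs_oedges T \<and>
     (\<exists>i u v k. a = (i, u, v) \<and> k \<le> 3 \<and> k \<noteq> u \<and> k \<noteq> v \<and>
        c = (fst (mate T (i, k)), glue T (i, k) u, glue T (i, k) v))"

definition oedge_map :: "('i, 'w) triang \<Rightarrow> 'i \<times> nat \<times> nat \<Rightarrow> ('i \<times> nat \<times> nat) set" where
  "oedge_map T a = {c. equivclp (oedge_id T) a c}"

definition oedges :: "('i, 'w) triang \<Rightarrow> ('i \<times> nat \<times> nat) set set" where
  "oedges T = oedge_map T ` abs_oedges T"

definition vertex_pt :: "('i, 'w) triang \<Rightarrow> 'i \<Rightarrow> nat \<Rightarrow> 'w" where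
  "vertex_pt T i v = quo T (i, tet_vertex v)"

definition quasi_regular :: "('i, 'w) triang \<Rightarrow> bool" where
  "quasi_regular T \<longleftrightarrow> (\<forall>(i, u, v)\<in>abs_oedges T. vertex_pt T i u \<noteq> vertex_pt T i v)"


section \<open>Branchings\<close>

text \<open>A branching is given by the set \<open>b\<close> of the positively oriented edges of \<open>T\<close>.\<close>

definition branch_order ::
    "('i, 'w) triang \<Rightarrow> ('i \<times> nat \<times> nat) set set \<Rightarrow> 'i \<Rightarrow> (nat \<Rightarrow> nat) \<Rightarrow> bool" where
  "branch_order T b i s \<longleftrightarrow> bij_betw s {..3} {..3} \<and>
     (\<forall>n\<le>3. \<forall>m<n. oedge_map T (i, s m, s n) \<in> b)"

definition branching :: "('i, 'w) triang \<Rightarrow> ('i \<times> nat \<times> nat) set set \<Rightarrow> bool" where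
  "branching T b \<longleftrightarrow> b \<subseteq> oedges T \<and>
     (\<forall>(i, u, v)\<in>abs_oedges T. (oedge_map T (i, u, v) \<in> b) \<noteq> (oedge_map T (i, v, u) \<in> b)) \<and>
     (\<forall>i\<in>tets T. \<exists>s. branch_order T b i s)"

text \<open>\<open>bvert T b i m\<close> is the vertex \<open>v\<^sub>m\<close> of the branched tetrahedron \<open>i\<close>; for \<open>m \<le> 3\<close> it is uniquely
  determined.\<close>

definition bvert :: "('i, 'w) triang \<Rightarrow> ('i \<times> nat \<times> nat) set set \<Rightarrow> 'i \<Rightarrow> nat \<Rightarrow> nat" where
  "bvert T b i = (SOME s. branch_order T b i s)"

text \<open>The frame \<open>([v\<^sub>0,v\<^sub>1], [v\<^sub>0,v\<^sub>2], [v\<^sub>0,v\<^sub>3])\<close> defines the same orientation as the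
  ordered simplex \<open>(v\<^sub>0,v\<^sub>1,v\<^sub>2,v\<^sub>3)\<close>.\<close>

definition branch_index ::
    "'w topology \<Rightarrow> ('w \<Rightarrow> 'w chain set) \<Rightarrow> ('i, 'w) triang \<Rightarrow> ('i \<times> nat \<times> nat) set set \<Rightarrow> 'i \<Rightarrow> int"
  where
  "branch_index W ori T b i =
     (if \<forall>x\<in>open_tet. local_class W (tet_simplex T i (bvert T b i)) x
                       = ori (tet_simplex T i (bvert T b i) x)
      then 1 else -1)"


section \<open>Cocycles\<close>

definition cocycle :: "('i, 'w) triang \<Rightarrow> (('i \<times> nat \<times> nat) set \<Rightarrow> (complex^2^2) set) \<Rightarrow> bool" where
  "cocycle T z \<longleftrightarrow>
     (\<forall>(i, u, v)\<in>abs_oedges T. z (oedge_map T (i, u, v)) \<in> carrier PSL2C \<and>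
        z (oedge_map T (i, v, u)) = inv\<^bsub>PSL2C\<^esub> z (oedge_map T (i, u, v))) \<and>
     (\<forall>i\<in>tets T. \<forall>x\<le>3. \<forall>y\<le>3. \<forall>t\<le>3. x \<noteq> y \<and> y \<noteq> t \<and> x \<noteq> t \<longrightarrow>
        z (oedge_map T (i, x, y)) \<otimes>\<^bsub>PSL2C\<^esub> z (oedge_map T (i, y, t)) = z (oedge_map T (i, x, t)))"

text \<open>A cocycle represents the bundle \<open>R\<close> if, for some choice \<open>s\<close> of a point in the fibre over each
  vertex of \<open>T\<close>, parallel transport along every oriented edge \<open>e\<close> from \<open>v\<close> to \<open>v'\<close> takes
  \<open>s(v) z(e)\<close> to \<open>s(v')\<close>. Since the fibres of \<open>R\<close> are discrete, parallel transport is
  lifting of paths. Replacing \<open>s(v)\<close> by \<open>s(v) \<lambda>(v)\<close> replaces \<open>z(e)\<close> by \<open>\<lambda>(v)\<^sup>-\<^sup>1 z(e) \<lambda>(v')\<close>.\<close>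

definition represents ::
    "('i, 'w) triang \<Rightarrow> (('i \<times> nat \<times> nat) set \<Rightarrow> (complex^2^2) set) \<Rightarrow>
       ('p, 'w, (complex^2^2) set) gbundle \<Rightarrow> bool" where
  "represents T z R \<longleftrightarrow>
     (\<exists>s :: 'w \<Rightarrow> 'p.
        (\<forall>i\<in>tets T. \<forall>v\<le>3. s (vertex_pt T i v) \<in> topspace (total R) \<and>
           proj R (s (vertex_pt T i v)) = vertex_pt T i v) \<and>
        (\<forall>(i, u, v)\<in>abs_oedges T. \<exists>g. pathin (total R) g \<and>
           (\<forall>t\<in>{0..1}. proj R (g t)
              = quo T (i, \<lambda>j. (1 - t) * tet_vertex u j + t * tet_vertex v j)) \<and>
           g 0 = ract R (s (vertex_pt T i u)) (z (oedge_map T (i, u, v))) \<and>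
           g 1 = s (vertex_pt T i v)))"


section \<open>Idealization\<close>

definition bcocyc ::
    "('i, 'w) triang \<Rightarrow> ('i \<times> nat \<times> nat) set set \<Rightarrow> (('i \<times> nat \<times> nat) set \<Rightarrow> (complex^2^2) set) \<Rightarrow>
       'i \<Rightarrow> nat \<Rightarrow> nat \<Rightarrow> (complex^2^2) set" where
  "bcocyc T b z i m n = z (oedge_map T (i, bvert T b i m, bvert T b i n))"

text \<open>The points \<open>u\<^sub>0, u\<^sub>1, u\<^sub>2, u\<^sub>3\<close>; here \<open>z\<^sub>0 = z [v\<^sub>0,v\<^sub>1]\<close>, \<open>z\<^sub>1 = z [v\<^sub>1,v\<^sub>2]\<close> and
  \<open>z'\<^sub>0 = z [v\<^sub>2,v\<^sub>3]\<close>.\<close>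

definition upt_cp1 ::
    "('i, 'w) triang \<Rightarrow> ('i \<times> nat \<times> nat) set set \<Rightarrow> (('i \<times> nat \<times> nat) set \<Rightarrow> (complex^2^2) set) \<Rightarrow>
       'i \<Rightarrow> nat \<Rightarrow> cp1" where
  "upt_cp1 T b z i k =
     (let z0 = bcocyc T b z i 0 1; z1 = bcocyc T b z i 1 2; z0' = bcocyc T b z i 2 3 in
      if k = 0 then Fin_pt 0
      else if k = 1 then psl_act z0 (Fin_pt 0)
      else if k = 2 then psl_act (z0 \<otimes>\<^bsub>PSL2C\<^esub> z1) (Fin_pt 0)
      else psl_act (z0 \<otimes>\<^bsub>PSL2C\<^esub> z1 \<otimes>\<^bsub>PSL2C\<^esub> z0') (Fin_pt 0))"

definition idealizable ::
    "('i, 'w) triang \<Rightarrow> ('i \<times> nat \<times> nat) set set \<Rightarrow> (('i \<times> nat \<times> nat) set \<Rightarrow> (complex^2^2) set) \<Rightarrow>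
       'i \<Rightarrow> bool" where
  "idealizable T b z i \<longleftrightarrow>
     (\<forall>k\<le>3. upt_cp1 T b z i k \<noteq> Infty) \<and> inj_on (upt_cp1 T b z i) {..3}"

definition pval ::
    "('i, 'w) triang \<Rightarrow> ('i \<times> nat \<times> nat) set set \<Rightarrow> (('i \<times> nat \<times> nat) set \<Rightarrow> (complex^2^2) set) \<Rightarrow>
       'i \<Rightarrow> nat \<Rightarrow> complex" where
  "pval T b z i j =
     (let u = (\<lambda>k. coord (upt_cp1 T b z i k)) in
      if j = 0 then u 1 * (u 3 - u 2)
      else if j = 1 then (u 2 - u 1) * u 3
      else - u 2 * (u 3 - u 1))"

definition wval ::
    "('i, 'w) triang \<Rightarrow> ('i \<times> nat \<times> nat) set set \<Rightarrow> (('i \<times> nat \<times> nat) set \<Rightarrow> (complex^2^2) set) \<Rightarrow>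
       'i \<Rightarrow> nat \<Rightarrow> complex" where
  "wval T b z i j = - pval T b z i ((j + 1) mod 3) / pval T b z i ((j + 2) mod 3)"

definition edge_modulus ::
    "('i, 'w) triang \<Rightarrow> ('i \<times> nat \<times> nat) set set \<Rightarrow> (('i \<times> nat \<times> nat) set \<Rightarrow> (complex^2^2) set) \<Rightarrow>
       'i \<times> nat set \<Rightarrow> complex" where
  "edge_modulus T b z a =
     (let i = fst a; v = bvert T b i in
      if snd a \<in> {{v 0, v 1}, {v 2, v 3}} then wval T b z i 0
      else if snd a \<in> {{v 1, v 2}, {v 0, v 3}} then wval T b z i 1
      else wval T b z i 2)"

definition D_triangulation ::
    "'w topology \<Rightarrow> ('w \<Rightarrow> 'w chain set) \<Rightarrow> ('p, 'w, (complex^2^2) set) gbundle \<Rightarrow>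
       ('i, 'w) triang \<Rightarrow> ('i \<times> nat \<times> nat) set set \<Rightarrow>
       (('i \<times> nat \<times> nat) set \<Rightarrow> (complex^2^2) set) \<Rightarrow> bool" where
  "D_triangulation W ori R T b z \<longleftrightarrow>
     triangulation W ori T \<and> quasi_regular T \<and> branching T b \<and> cocycle T z \<and> represents T z R \<and>
     (\<forall>i\<in>tets T. idealizable T b z i)"

definition I_triangulation ::
    "'w topology \<Rightarrow> ('w \<Rightarrow> 'w chain set) \<Rightarrow> ('p, 'w, (complex^2^2) set) gbundle \<Rightarrow>
       ('i, 'w) triang \<Rightarrow> ('i \<times> nat \<times> nat) set set \<Rightarrow> ('i \<times> nat set \<Rightarrow> complex) \<Rightarrow> bool" where
  "I_triangulation W ori R T b w \<longleftrightarrow>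
     (\<exists>z. D_triangulation W ori R T b z \<and> (\<forall>a\<in>abs_edges T. w a = edge_modulus T b z a))"

end

theory Submission
  imports Defs
begin

text \<open>Orient the edge \<open>e\<close>. An abstract edge over it then has a first endpoint \<open>p\<close> and a second endpoint \<open>q\<close>,
and the two other vertices of its tetrahedron can be named \<open>r\<close>, \<open>s\<close> in exactly one way such that the
ordering \<open>(p, q, r, s)\<close> agrees with the orientation of \<open>W\<close>. Developing the tetrahedron from \<open>p\<close>
sends a vertex \<open>x\<close> to the point \<open>z([p,x])(0)\<close> of the projective line, and \<open>w\<^sup>*\<close> of the abstract edge is
the cross ratio of the four developed points (\<open>modulus_vertex_ratio\<close>). It is therefore a quotient
\<open>\<phi>(s) / \<phi>(r)\<close>, where \<open>\<phi>\<close> is a coordinate that is \<open>0\<close> at the point of \<open>p\<close> and \<open>\<infinity>\<close> at that of \<open>q\<close>.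
Since \<open>\<phi>(x)\<close> is computed from \<open>z([p,q])\<close> and \<open>z([p,x])\<close> alone, it belongs to the face \<open>pqx\<close> and has the
same value in both tetrahedra at that face.

Crossing the face \<open>pqs\<close> leads to the next abstract edge over \<open>e\<close>, where \<open>s\<close> takes the place of \<open>r\<close>.
This step is a permutation of the abstract edges over \<open>e\<close>: it is undone by crossing the same face
backwards, and a branching forbids that it comes back to an edge with \<open>p\<close> and \<open>q\<close> exchanged. So every
numerator of the product is the denominator of exactly one factor, and the product is \<open>1\<close>.

What makes the step well defined is that crossing a face preserves positivity, that is, that the face
identifications reverse the orientations (\<open>gluing_reverses_orientation\<close>). The orientation of \<open>W\<close> is a
family of local homology classes, so this is a statement about \<open>H\<^sub>3(W, W - x)\<close> for \<open>x\<close> inside a face.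
Cone off the face to the barycentres of the two tetrahedra. The difference of the two cones is a
relative cycle at \<open>x\<close>, because the face itself cancels; hence it is \<open>n\<close> times the orientation class at
\<open>x\<close>, and also at all points near \<open>x\<close>. At such points on the two sides of the face the difference is the
class of one tetrahedron and minus the class of the other. The local homology groups are infinite
cyclic (\<open>local_homology_iso_integer\<close>), so both signs can be compared with \<open>n\<close>, and they are opposite.
Cones are used instead of the whole tetrahedra because the two faces may belong to the same
tetrahedron. The same homological computations show that exchanging two vertices of a tetrahedron
negates its local class, so that the index \<open>*\<close> is the sign of a permutation
(\<open>branch_index_eq_perm_sign\<close>).\<close>

section \<open>Local homology of closed 3-manifolds\<close>

text \<open>Excision reduces to a Euclidean chart, where the point can be moved to the origin. The local homology of
\<open>\<real>\<^sup>n\<close> at the origin is shifted by suspension when \<open>n\<close> grows, so that in degree \<open>3\<close> it is the homology of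
a single point in degree \<open>0\<close>.\<close>

lemma local_homology_iso_integer:
  assumes W: "closed_3manifold W" and x: "x \<in> topspace W"
  shows "relative_homology_group 3 W (topspace W - {x}) \<cong> integer_group"
proof -
  obtain U where U: "openin W U" "x \<in> U"
    and hU: "subtopology W U homeomorphic_space Euclidean_space 3"
    using W x by (auto simp: closed_3manifold_def)
  have UW: "U \<subseteq> topspace W" using U openin_subset by blast
  obtain f where f: "homeomorphic_map (subtopology W U) (Euclidean_space 3) f"
    using hU by (auto simp: homeomorphic_space)
  have t1: "t1_space W" using W by (simp add: closed_3manifold_def Hausdorff_imp_t1_space)
  let ?E = "Euclidean_space 3"
  let ?T = "topspace W - {x}"
  have op: "openin W ?T"
    using t1 x by (simp add: t1_space_closedin_singleton openin_diff)
  have cl: "closedin W (topspace W - U)" using U by (simp add: closedin_def UW double_diff)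
  have "hom_induced 3 (subtopology W (topspace W - (topspace W - U))) (?T - (topspace W - U))
        (subtopology W (topspace W)) ?T id
    \<in> iso (relative_homology_group 3 (subtopology W (topspace W - (topspace W - U))) (?T - (topspace W - U)))
          (relative_homology_group 3 (subtopology W (topspace W)) ?T)"
    using U UW by (intro homology_excision_axiom)
      (auto simp: closure_of_closedin[OF cl] interior_of_openin[OF op])
  moreover have "topspace W - (topspace W - U) = U" "?T - (topspace W - U) = U - {x}" using UW by auto
  ultimately have i1: "relative_homology_group 3 (subtopology W U) (U - {x})
       \<cong> relative_homology_group 3 W ?T"
    by (metis is_isoI subtopology_topspace)
  have tU: "topspace (subtopology W U) = U" using UW by auto
  have fb: "bij_betw f U (topspace ?E)"
    using f tU by (metis bij_betw_def homeomorphic_imp_injective_map homeomorphic_imp_surjective_map)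
  have "f ` (U - {x}) = topspace ?E - {f x}"
    using fb U by (auto simp: bij_betw_def inj_on_def)
  then have "hom_induced 3 (subtopology W U) (U - {x}) ?E (topspace ?E - {f x}) f
     \<in> iso (relative_homology_group 3 (subtopology W U) (U - {x}))
           (relative_homology_group 3 ?E (topspace ?E - {f x}))"
    using f tU by (intro homeomorphic_map_relative_homology_iso) auto
  then have i2: "relative_homology_group 3 (subtopology W U) (U - {x})
       \<cong> relative_homology_group 3 ?E (topspace ?E - {f x})" by (rule is_isoI)
  have fx: "f x \<in> topspace ?E" using fb U by (auto simp: bij_betw_def)
  define o0 where "o0 = (\<lambda>i::nat. 0::real)"
  have o0: "o0 \<in> topspace (Euclidean_space n)" for n by (simp add: o0_def topspace_Euclidean_space)
  have sing: "subtopology ?E {f x} homeomorphic_space subtopology ?E {o0}"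
  proof -
    have "topspace (subtopology ?E {f x}) = {f x}" "topspace (subtopology ?E {o0}) = {o0}"
      using fx o0 by auto
    then show ?thesis
      unfolding homeomorphic_space_def homeomorphic_maps_def
      by (intro exI[of _ "\<lambda>_. o0"] exI[of _ "\<lambda>_. f x"]) auto
  qed
  have i3: "relative_homology_group 3 ?E (topspace ?E - {f x})
     \<cong> relative_homology_group 3 ?E (topspace ?E - {o0})"
    using fx o0 sing
    by (intro isomorphic_relative_homology_groups_Euclidean_complements)
       (auto simp: closedin_Euclidean_space_iff)
  have E0: "topspace (Euclidean_space 0) = {o0}"
    by (auto simp: topspace_Euclidean_space o0_def)
  have "relative_homology_group 0 (Euclidean_space 0) (topspace(Euclidean_space 0) - {o0})
      \<cong> relative_homology_group (0 + int 3) (Euclidean_space (0+3)) (topspace(Euclidean_space (0+3)) - {o0})"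
    by (intro relative_homology_group_Euclidean_complement_step) (simp add: closedin_Euclidean_space_iff E0)
  then have i4: "homology_group 0 (Euclidean_space 0) \<cong> relative_homology_group 3 ?E (topspace ?E - {o0})"
    by (simp add: E0)
  have "path_connected_space (Euclidean_space 0)"
    unfolding path_connected_space_def E0 using o0[of 0]
    by (auto intro!: exI[of _ "\<lambda>_. o0"] simp: pathin_def)
  then have i5: "homology_group 0 (Euclidean_space 0) \<cong> integer_group"
    by (intro isomorphic_integer_zeroth_homology_group) (auto simp: E0)
  note s = group.iso_sym[OF group_relative_homology_group]
  show ?thesis
    using i1 i2 i3 i4 i5 s iso_trans by meson
qed

text \<open>Needed to read off integer multiples of an orientation class: no nontrivial power of a generator
is trivial.\<close>

lemma generator_of_integers_infinite_order:
  assumes G: "group G" and iso: "G \<cong> integer_group" and g: "g \<in> carrier G"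
    and gen: "generate G {g} = carrier G" and n: "g [^]\<^bsub>G\<^esub> (n::int) = \<one>\<^bsub>G\<^esub>"
  shows "n = 0"
proof -
  interpret G: group G by (fact G)
  obtain h where h: "h \<in> iso G integer_group" using iso by (auto simp: is_iso_def)
  interpret h: group_hom G integer_group h
    using h by (intro group_hom.intro group_hom_axioms.intro G) (auto simp: iso_def)
  have bij: "bij_betw h (carrier G) UNIV" using h by (auto simp: iso_def)
  have "h g \<noteq> 0"
  proof
    assume "h g = 0"
    then have "g = \<one>\<^bsub>G\<^esub>" using bij g G.one_closed h.hom_one unfolding bij_betw_def inj_on_def
      by (metis one_integer_group)
    then have "carrier G = {\<one>\<^bsub>G\<^esub>}" using gen G.generate_one by simp
    then have "finite (UNIV::int set)" using bij by (metis bij_betw_finite finite.emptyI finite.insertI)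
    then show False by (simp add: infinite_UNIV_int)
  qed
  moreover have "h (g [^]\<^bsub>G\<^esub> n) = n * h g"
    using h.hom_int_pow[OF g, of n] by simp
  ultimately show ?thesis using n h.hom_one by simp
qed

text \<open>Translates the powers in the definition of a triangulation into multiples of chains.\<close>

lemma int_pow_homology_class:
  assumes c: "singular_relcycle p X S c"
  shows "homologous_rel_set p X S c [^]\<^bsub>relative_homology_group (int p) X S\<^esub> (n::int)
         = homologous_rel_set p X S (frag_cmul n c)"
proof -
  let ?G = "relative_homology_group (int p) X S"
  let ?h = "\<lambda>a. homologous_rel_set p X S a"
  interpret G: group ?G by simp
  have carr: "?h a \<in> carrier ?G" if "singular_relcycle p X S a" for a
    using that by (auto simp: carrier_relative_homology_group)
  have mul: "?h a \<otimes>\<^bsub>?G\<^esub> ?h a' = ?h (a + a')"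
    if "singular_relcycle p X S a" "singular_relcycle p X S a'" for a a'
    unfolding mult_relative_homology_group
  proof (auto intro: homologous_rel_add)
    fix y assume y: "homologous_rel p X S (a + a') y"
    show "\<exists>r. homologous_rel p X S a r \<and> (\<exists>s. homologous_rel p X S a' s \<and> y = r + s)"
      using homologous_rel_diff[OF y homologous_rel_refl[of _ _ _ a]]
      by (intro exI[of _ a] conjI exI[of _ "y - a"]) auto
  qed
  note cm = singular_relcycle_cmul[OF c]
  show ?thesis
  proof (induction n rule: int_induct[where k=0])
    case base
    show ?case using homologous_rel_set_eq_relboundary[of p X S 0] by simp
  next
    case (step1 i)
    then show ?case
      using carr[OF c] mul[OF cm c] by (simp add: G.int_pow_mult frag_cmul_distrib)
  next
    case (step2 i)
    have "?h c [^]\<^bsub>?G\<^esub> (i-1) \<otimes>\<^bsub>?G\<^esub> ?h c = ?h c [^]\<^bsub>?G\<^esub> i"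
      using carr[OF c] G.int_pow_mult[of "?h c" "i-1" 1] by simp
    also have "\<dots> = ?h (frag_cmul (i-1) c + c)"
      using step2 by (simp add: frag_cmul_diff_distrib)
    also have "\<dots> = ?h (frag_cmul (i-1) c) \<otimes>\<^bsub>?G\<^esub> ?h c" using mul[OF cm c] by simp
    finally show ?case using carr[OF c] carr[OF cm] G.int_pow_closed by (meson G.right_cancel)
  qed
qed

lemma frag_cmul_uminus: "frag_cmul n (- a) = frag_cmul (- n) a"
  using frag_cmul_cmul[of n "-1" a] by simp

lemma homologous_rel_cmul:
  "homologous_rel p X S a b \<Longrightarrow> homologous_rel p X S (frag_cmul n a) (frag_cmul n b)"
proof -
  have "frag_cmul n (a - b) = frag_cmul n a - frag_cmul n b"
    using frag_cmul_distrib2[of n a "-b"] frag_cmul_cmul[of "-1" n b] by (simp add: frag_cmul_uminus)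
  then show "homologous_rel p X S a b \<Longrightarrow> homologous_rel p X S (frag_cmul n a) (frag_cmul n b)"
    unfolding homologous_rel_def by (metis singular_relboundary_cmul)
qed

text \<open>A homology modulo the complement of \<open>x\<close> uses only finitely many singular simplices that miss \<open>x\<close>. Their
images are compact, hence closed, so that they also miss a neighbourhood of \<open>x\<close>.\<close>

lemma homologous_rel_nearby:
  assumes W: "Hausdorff_space W" and x: "x \<in> topspace W"
    and h: "homologous_rel p W (topspace W - {x}) a b"
  obtains N where "openin W N" "x \<in> N" "\<And>y. y \<in> N \<Longrightarrow> homologous_rel p W (topspace W - {y}) a b"
proof -
  obtain d e where d: "singular_chain (Suc p) W d"
    and e: "singular_chain p (subtopology W (topspace W - {x})) e"
    and de: "chain_boundary (Suc p) d + e = a - b"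
    using h unfolding homologous_rel_def singular_relboundary by blast
  define K where "K = (\<Union>f\<in>Poly_Mapping.keys e. f ` standard_simplex p)"
  have eW: "singular_chain p W e" and eK: "x \<notin> K"
    using e by (auto simp: singular_chain_subtopology K_def)
  have "compactin W (f ` standard_simplex p)" if "f \<in> Poly_Mapping.keys e" for f
  proof -
    have "continuous_map (subtopology (powertop_real UNIV) (standard_simplex p)) W f"
      using eW that by (auto simp: singular_chain_def singular_simplex_def)
    moreover have "compactin (subtopology (powertop_real UNIV) (standard_simplex p)) (standard_simplex p)"
      by (simp add: compactin_subtopology compactin_standard_simplex)
    ultimately show ?thesis by (rule image_compactin[rotated])
  qed
  then have "closedin W K" unfolding K_def
    by (intro closedin_Union) (auto intro: compactin_imp_closedin[OF W])
  then have 1: "openin W (topspace W - K)" by (simp add: closedin_def)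
  have "homologous_rel p W (topspace W - {y}) a b" if "y \<in> topspace W - K" for y
  proof -
    have "f ` standard_simplex p \<subseteq> topspace W - {y}" if "f \<in> Poly_Mapping.keys e" for f
      using e that \<open>y \<in> topspace W - K\<close> by (auto simp: singular_chain_subtopology K_def)
    then have "singular_chain p (subtopology W (topspace W - {y})) e"
      using eW by (auto simp: singular_chain_subtopology)
    then show ?thesis using d de unfolding homologous_rel_def singular_relboundary by blast
  qed
  with 1 x eK show thesis by (intro that[of "topspace W - K"]) auto
qed

lemma orientation_infinite_order:
  assumes W: "closed_oriented_3manifold W ori" and y: "y \<in> topspace W"
    and C: "ori y = homologous_rel_set 3 W (topspace W - {y}) C"
    and n: "singular_relboundary 3 W (topspace W - {y}) (frag_cmul n C)"
  shows "n = 0"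
proof -
  let ?G = "relative_homology_group (int 3) W (topspace W - {y})"
  have o: "ori y \<in> carrier ?G" "generate ?G {ori y} = carrier ?G"
    using W y by (auto simp: closed_oriented_3manifold_def orientation_def)
  obtain c where c: "singular_relcycle 3 W (topspace W - {y}) c" "ori y = homologous_rel_set 3 W (topspace W - {y}) c"
    using o(1) unfolding carrier_relative_homology_group by auto
  have rc: "singular_relcycle 3 W (topspace W - {y}) C"
    using c C homologous_rel_set_eq[of 3 W "topspace W - {y}" c C] homologous_rel_singular_relcycle_1 by metis
  have "ori y [^]\<^bsub>?G\<^esub> n = \<one>\<^bsub>?G\<^esub>"
    unfolding C int_pow_homology_class[OF rc] one_relative_homology_group
    using n homologous_rel_set_eq_relboundary by blast
  then show ?thesis
    using W y o by (intro generator_of_integers_infinite_order[of ?G "ori y" n] local_homology_iso_integer[of W y, simplified])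
      (auto simp: closed_oriented_3manifold_def local_homology_iso_integer)
qed

lemma orientation_generates:
  assumes W: "closed_oriented_3manifold W ori" and y: "y \<in> topspace W"
    and C: "ori y = homologous_rel_set 3 W (topspace W - {y}) C"
    and D: "singular_relcycle 3 W (topspace W - {y}) D"
  obtains m where "homologous_rel 3 W (topspace W - {y}) D (frag_cmul m C)"
proof -
  let ?G = "relative_homology_group (int 3) W (topspace W - {y})"
  interpret G: group ?G by simp
  have o: "ori y \<in> carrier ?G" "generate ?G {ori y} = carrier ?G"
    using W y by (auto simp: closed_oriented_3manifold_def orientation_def)
  obtain c where c: "singular_relcycle 3 W (topspace W - {y}) c" "ori y = homologous_rel_set 3 W (topspace W - {y}) c"
    using o(1) unfolding carrier_relative_homology_group by auto
  have rc: "singular_relcycle 3 W (topspace W - {y}) C"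
    using c C homologous_rel_set_eq[of 3 W "topspace W - {y}" c C] homologous_rel_singular_relcycle_1 by metis
  have "homologous_rel_set 3 W (topspace W - {y}) D \<in> generate ?G {ori y}"
    using D unfolding o(2) carrier_relative_homology_group by auto
  then obtain m :: int where "homologous_rel_set 3 W (topspace W - {y}) D = ori y [^]\<^bsub>?G\<^esub> m"
    unfolding G.generate_pow[OF o(1)] by auto
  then have "homologous_rel_set 3 W (topspace W - {y}) D = homologous_rel_set 3 W (topspace W - {y}) (frag_cmul m C)"
    unfolding C int_pow_homology_class[OF rc] .
  then show thesis using that homologous_rel_set_eq by blast
qed

text \<open>One chain \<open>C\<close> represents the orientation at all points near \<open>x\<close>. This is the only place where the
continuity of the orientation enters.\<close>

lemma local_orientation_chain:
  assumes W: "closed_oriented_3manifold W ori" and x: "x \<in> topspace W"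
  obtains U C where "openin W U" "x \<in> U"
    "\<And>y. y \<in> U \<Longrightarrow> ori y = homologous_rel_set 3 W (topspace W - {y}) C"
proof -
  obtain U c where U: "openin W U" "x \<in> U"
    and c: "c \<in> carrier (relative_homology_group (int 3) W (topspace W - U))"
    and h: "\<And>y. y \<in> U \<Longrightarrow> hom_induced (int 3) W (topspace W - U) W (topspace W - {y}) id c = ori y"
    using W x by (auto simp: closed_oriented_3manifold_def orientation_def)
  obtain C where C: "singular_relcycle 3 W (topspace W - U) C" "c = homologous_rel_set 3 W (topspace W - U) C"
    using c unfolding carrier_relative_homology_group by auto
  have "ori y = homologous_rel_set 3 W (topspace W - {y}) C" if y: "y \<in> U" for y
  proof -
    have "chain_map 3 id C = C" using C(1) by (auto simp: singular_relcycle intro: chain_map_id_gen)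
    moreover have "id \<in> topspace W - U \<rightarrow> topspace W - {y}" using y by auto
    ultimately show ?thesis
      using hom_induced_chain_map[of W W id "topspace W - U" "topspace W - {y}" 3 C] C
      unfolding h[OF y, symmetric] C(2) by simp
  qed
  with U show thesis by (rule that)
qed

section \<open>Affine simplices in a tetrahedron\<close>

text \<open>The vertices are given as a list so that faces are obtained by deleting entries.\<close>

definition affine_simplex :: "((nat \<Rightarrow> real) \<Rightarrow> 'w) \<Rightarrow> (nat \<Rightarrow> real) list \<Rightarrow> (nat \<Rightarrow> real) \<Rightarrow> 'w" where
  "affine_simplex g vs = simplex_map (length vs - 1) g (oriented_simplex (length vs - 1) (\<lambda>j. vs ! j))"

definition vertex_hull :: "(nat \<Rightarrow> real) list \<Rightarrow> (nat \<Rightarrow> real) set" where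
  "vertex_hull vs = (\<lambda>x i. \<Sum>j\<le>length vs - 1. (vs ! j) i * x j) ` standard_simplex (length vs - 1)"

lemma vertex_hull_subset_simplex:
  assumes "vs \<noteq> []" "set vs \<subseteq> standard_simplex m"
  shows "vertex_hull vs \<subseteq> standard_simplex m"
proof -
  let ?n = "length vs - 1"
  have v: "vs ! j \<in> standard_simplex m" if "j \<le> ?n" for j
    using that assms by (metis One_nat_def Suc_pred le_imp_less_Suc length_greater_0_conv nth_mem subsetD)
  have "(\<lambda>i. \<Sum>j\<le>?n. (vs ! j) i * x j) \<in> standard_simplex m" if x: "x \<in> standard_simplex ?n" for x
  proof -
    have x0: "\<And>j. 0 \<le> x j" and x1: "(\<Sum>j\<le>?n. x j) = 1" using x by (auto simp: standard_simplex_def)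
    have b: "0 \<le> (vs ! j) i" "(vs ! j) i \<le> 1" if "j \<le> ?n" for j i using v[OF that] by (auto simp: standard_simplex_def)
    have z: "(vs ! j) i = 0" if "j \<le> ?n" "i > m" for j i using v[OF that(1)] that(2) by (auto simp: standard_simplex_def)
    have s: "(\<Sum>i\<le>m. (vs ! j) i) = 1" if "j \<le> ?n" for j using v[OF that] by (auto simp: standard_simplex_def)
    have "(\<Sum>i\<le>m. \<Sum>j\<le>?n. (vs ! j) i * x j) = (\<Sum>j\<le>?n. (\<Sum>i\<le>m. (vs ! j) i) * x j)"
      by (subst sum.swap) (simp add: sum_distrib_right)
    also have "\<dots> = 1" using s x1 by simp
    finally have 1: "(\<Sum>i\<le>m. \<Sum>j\<le>?n. (vs ! j) i * x j) = 1" .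
    have 2: "0 \<le> (\<Sum>j\<le>?n. (vs ! j) i * x j)" for i by (intro sum_nonneg mult_nonneg_nonneg b x0) auto
    have 3: "(\<Sum>j\<le>?n. (vs ! j) i * x j) \<le> 1" for i
    proof -
      have "(\<Sum>j\<le>?n. (vs ! j) i * x j) \<le> (\<Sum>j\<le>?n. 1 * x j)"
        by (intro sum_mono mult_right_mono b x0) auto
      then show ?thesis using x1 by simp
    qed
    show ?thesis using 1 2 3 z by (auto simp: standard_simplex_def)
  qed
  then show ?thesis by (auto simp: vertex_hull_def)
qed

lemma singular_simplex_affine_simplex:
  assumes g: "continuous_map (subtopology (powertop_real UNIV) (standard_simplex m)) W g"
    and vs: "vs \<noteq> []" "set vs \<subseteq> standard_simplex m"
    and S: "\<And>x. x \<in> vertex_hull vs \<Longrightarrow> g x \<in> S"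
  shows "singular_simplex (length vs - 1) (subtopology W S) (affine_simplex g vs)"
proof -
  let ?n = "length vs - 1"
  have im: "oriented_simplex ?n (\<lambda>j. vs ! j) ` standard_simplex ?n = vertex_hull vs"
    by (auto simp: oriented_simplex_def vertex_hull_def)
  have "simplicial_simplex ?n (standard_simplex m) (oriented_simplex ?n (\<lambda>j. vs ! j))"
    using vertex_hull_subset_simplex[OF vs] im by (auto simp: simplicial_simplex)
  then have "singular_simplex ?n (subtopology (powertop_real UNIV) (standard_simplex m)) (oriented_simplex ?n (\<lambda>j. vs ! j))"
    by (rule simplicial_imp_singular_simplex)
  then have "singular_simplex ?n W (affine_simplex g vs)"
    unfolding affine_simplex_def by (rule singular_simplex_simplex_map[OF _ g])
  moreover have "affine_simplex g vs ` standard_simplex ?n \<subseteq> S"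
    using S im by (auto simp: affine_simplex_def simplex_map_def)
  ultimately show ?thesis by (simp add: singular_simplex_subtopology)
qed

lemma singular_face_affine_simplex:
  assumes "length vs = Suc n" "1 \<le> n" "k \<le> n"
  shows "singular_face n k (affine_simplex g vs) = affine_simplex g (take k vs @ drop (Suc k) vs)"
proof -
  have l: "length (take k vs @ drop (Suc k) vs) - 1 = n - 1" using assms by auto
  have nth: "(take k vs @ drop (Suc k) vs) ! j = (if j < k then vs ! j else vs ! Suc j)" if "j \<le> n - 1" for j
    using assms that by (auto simp: nth_append)
  have "singular_face n k (affine_simplex g vs)
       = simplex_map (n-1) g (singular_face n k (oriented_simplex n (\<lambda>j. vs ! j)))"
    using assms unfolding affine_simplex_def
    by (simp add: singular_face_simplex_map) (auto simp: simplex_map_def singular_face_def fun_eq_iff)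
  also have "singular_face n k (oriented_simplex n (\<lambda>j. vs ! j))
        = oriented_simplex (n - 1) (\<lambda>j. if j < k then vs ! j else vs ! Suc j)"
    using assms by (simp add: singular_face_oriented_simplex)
  also have "\<dots> = oriented_simplex (n-1) (\<lambda>j. (take k vs @ drop (Suc k) vs) ! j)"
    by (subst oriented_simplex_eq) (use nth in auto)
  finally show ?thesis unfolding affine_simplex_def l .
qed

lemma chain_boundary_affine_3:
  "chain_boundary 3 (frag_of (affine_simplex g [a,b,c,d]))
    = frag_of (affine_simplex g [b,c,d]) - frag_of (affine_simplex g [a,c,d])
      + frag_of (affine_simplex g [a,b,d]) - frag_of (affine_simplex g [a,b,c])"
  by (simp add: chain_boundary_of numeral_3_eq_3 singular_face_affine_simplex)

lemma chain_boundary_affine_4: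
  "chain_boundary 4 (frag_of (affine_simplex g [a,b,c,d,e]))
    = frag_of (affine_simplex g [b,c,d,e]) - frag_of (affine_simplex g [a,c,d,e])
      + frag_of (affine_simplex g [a,b,d,e]) - frag_of (affine_simplex g [a,b,c,e])
      + frag_of (affine_simplex g [a,b,c,d])"
  by (simp add: chain_boundary_of eval_nat_numeral singular_face_affine_simplex)

lemma vertex_hull_3:
  assumes "x \<in> vertex_hull [a,b,c]"
  obtains \<alpha> \<beta> \<gamma> where "0 \<le> \<alpha>" "0 \<le> \<beta>" "0 \<le> \<gamma>" "\<alpha> + \<beta> + \<gamma> = 1"
     "x = (\<lambda>i. a i * \<alpha> + b i * \<beta> + c i * \<gamma>)"
proof -
  obtain t where t: "t \<in> standard_simplex 2" "x = (\<lambda>i. \<Sum>j\<le>2. ([a,b,c] ! j) i * t j)"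
    using assms by (auto simp: vertex_hull_def numeral_2_eq_2)
  have e: "{..2::nat} = {0,1,2}" by auto
  show thesis
    using t by (intro that[of "t 0" "t 1" "t 2"]) (auto simp: standard_simplex_def e)
qed

lemma vertex_hull_4:
  assumes "x \<in> vertex_hull [a,b,c,d]"
  obtains \<alpha> \<beta> \<gamma> \<delta> where "0 \<le> \<alpha>" "0 \<le> \<beta>" "0 \<le> \<gamma>" "0 \<le> \<delta>" "\<alpha> + \<beta> + \<gamma> + \<delta> = 1"
     "x = (\<lambda>i. a i * \<alpha> + b i * \<beta> + c i * \<gamma> + d i * \<delta>)"
proof -
  obtain t where t: "t \<in> standard_simplex 3" "x = (\<lambda>i. \<Sum>j\<le>3. ([a,b,c,d] ! j) i * t j)"
    using assms by (auto simp: vertex_hull_def numeral_3_eq_3)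
  have e: "{..3::nat} = {0,1,2,3}" by auto
  show thesis
    using t by (intro that[of "t 0" "t 1" "t 2" "t 3"]) (auto simp: standard_simplex_def e add.assoc)
qed

lemma tet_vertex_in_simplex: "v \<le> n \<Longrightarrow> tet_vertex v \<in> standard_simplex n"
  by (simp add: tet_vertex_def)

text \<open>Every simplex that misses \<open>y\<close> is negligible in \<open>H\<^sub>3(W, W - y)\<close>.\<close>

lemma chain_avoids_point:
  assumes g: "continuous_map (subtopology (powertop_real UNIV) (standard_simplex 3)) W g"
    and vs: "length vs = Suc n" "set vs \<subseteq> standard_simplex 3"
    and av: "\<And>x. x \<in> vertex_hull vs \<Longrightarrow> x \<in> standard_simplex 3 \<Longrightarrow> g x \<noteq> y"
  shows "singular_chain n (subtopology W (topspace W - {y})) (frag_of (affine_simplex g vs))"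
proof -
  have ne: "vs \<noteq> []" using vs by auto
  have "singular_simplex (length vs - 1) (subtopology W (topspace W - {y})) (affine_simplex g vs)"
  proof (rule singular_simplex_affine_simplex[OF g ne vs(2)])
    fix x assume "x \<in> vertex_hull vs"
    moreover then have "x \<in> standard_simplex 3" using vertex_hull_subset_simplex[OF ne vs(2)] by auto
    ultimately show "g x \<in> topspace W - {y}" using av continuous_map_image_subset_topspace[OF g] by auto
  qed
  then show ?thesis using vs by (simp add: singular_chain_of)
qed

lemma relboundary_affine_4:
  assumes g: "continuous_map (subtopology (powertop_real UNIV) (standard_simplex 3)) W g"
    and vs: "{a,b,c,d,e} \<subseteq> standard_simplex 3"
  shows "singular_relboundary 3 W S
     (frag_of (affine_simplex g [b,c,d,e]) - frag_of (affine_simplex g [a,c,d,e])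
      + frag_of (affine_simplex g [a,b,d,e]) - frag_of (affine_simplex g [a,b,c,e])
      + frag_of (affine_simplex g [a,b,c,d]))"
proof -
  have "singular_simplex (length [a,b,c,d,e] - 1) (subtopology W (topspace W)) (affine_simplex g [a,b,c,d,e])"
    using g vs vertex_hull_subset_simplex[of "[a,b,c,d,e]" 3] continuous_map_image_subset_topspace[OF g]
    by (intro singular_simplex_affine_simplex[OF g]) auto
  then have "singular_chain (Suc 3) W (frag_of (affine_simplex g [a,b,c,d,e]))"
    by (simp add: singular_chain_of eval_nat_numeral)
  then show ?thesis
    unfolding singular_relboundary_def
    using chain_boundary_affine_4[of g a b c d e]
    by (intro exI[of _ "frag_of (affine_simplex g [a,b,c,d,e])"]) simp
qed

text \<open>The local classes of a tetrahedron are taken at points \<open>y\<close> of this kind: its proper faces miss them.\<close>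

abbreviation only_interior_preimages :: "((nat \<Rightarrow> real) \<Rightarrow> 'w) \<Rightarrow> 'w \<Rightarrow> bool" where
  "only_interior_preimages g y \<equiv> \<forall>x\<in>standard_simplex 3. g x = y \<longrightarrow> x \<in> open_tet"

lemma degenerate_relboundary:
  assumes g: "continuous_map (subtopology (powertop_real UNIV) (standard_simplex 3)) W g"
    and y: "only_interior_preimages g y"
    and vs: "set [a,b,c,d] \<subseteq> {..3}" "v \<le> 3" "v \<notin> set [a,b,c,d]"
  shows "singular_relboundary 3 W (topspace W - {y}) (frag_of (affine_simplex g (map tet_vertex [a,b,c,d])))"
proof (intro singular_chain_imp_relboundary chain_avoids_point[OF g])
  fix x assume x: "x \<in> vertex_hull (map tet_vertex [a,b,c,d])" "x \<in> standard_simplex 3"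
  obtain \<alpha> \<beta> \<gamma> \<delta> where
    "x = (\<lambda>i. tet_vertex a i * \<alpha> + tet_vertex b i * \<beta> + tet_vertex c i * \<gamma> + tet_vertex d i * \<delta>)"
    using x(1) by (auto elim: vertex_hull_4)
  then have "x v = 0" using vs by (simp add: tet_vertex_def)
  then have "x \<notin> open_tet" using vs by (auto simp: open_tet_def)
  then show "g x \<noteq> y" using y x by blast
qed (use vs in \<open>auto intro: tet_vertex_in_simplex\<close>)

text \<open>Exchanging neighbours \<open>a\<close>, \<open>b\<close> in the vertex list negates the local class. In the boundary of the
degenerate 4-simplex with vertices \<open>a, b, a\<close> in place of \<open>a, b\<close>, deleting the first or the last \<open>a\<close>
gives the two orderings with the same sign; every other face lacks a vertex of the tetrahedron and
so lies in its boundary.\<close>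

lemma affine_swap:
  assumes g: "continuous_map (subtopology (powertop_real UNIV) (standard_simplex 3)) W g"
    and y: "only_interior_preimages g y"
    and vs: "{a,b,c,d} = {..3::nat}"
  defines "F \<equiv> \<lambda>vs. frag_of (affine_simplex g (map tet_vertex vs))"
  shows "homologous_rel 3 W (topspace W - {y}) (F [b,a,c,d]) (- F [a,b,c,d])"
    and "homologous_rel 3 W (topspace W - {y}) (F [a,c,b,d]) (- F [a,b,c,d])"
    and "homologous_rel 3 W (topspace W - {y}) (F [a,b,d,c]) (- F [a,b,c,d])"
proof -
  let ?S = "topspace W - {y}"
  have le: "a \<le> 3" "b \<le> 3" "c \<le> 3" "d \<le> 3" using vs by auto
  have "card {a,b,c,d} = 4" using vs by simp
  then have dist: "distinct [a,b,c,d]" by (intro card_distinct) simp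
  have vx: "tet_vertex v \<in> standard_simplex 3" if "v \<in> {a,b,c,d}" for v
    using that le by (auto intro: tet_vertex_in_simplex)
  have dg: "singular_relboundary 3 W ?S (F [a',b',c',d'])"
    if "set [a',b',c',d'] \<subseteq> {..3}" "v \<le> 3" "v \<notin> set [a',b',c',d']" for a' b' c' d' v
    unfolding F_def by (rule degenerate_relboundary[OF g y that])
  note bd = relboundary_affine_4[OF g, where S = ?S]
  have X: "singular_relboundary 3 W ?S (F [b,a,c,d] - F [a,a,c,d] + F [a,b,c,d] - F [a,b,a,d] + F [a,b,a,c])"
    using bd[of "tet_vertex a" "tet_vertex b" "tet_vertex a" "tet_vertex c" "tet_vertex d"] vx
    by (simp add: F_def)
  have Y: "singular_relboundary 3 W ?S (F [a,a,c,d])" "singular_relboundary 3 W ?S (F [a,b,a,d])"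
      "singular_relboundary 3 W ?S (F [a,b,a,c])"
    using dg[of a a c d b] dg[of a b a d c] dg[of a b a c d] le dist by auto
  have "singular_relboundary 3 W ?S ((F [b,a,c,d] - F [a,a,c,d] + F [a,b,c,d] - F [a,b,a,d] + F [a,b,a,c])
     + F [a,a,c,d] + F [a,b,a,d] - F [a,b,a,c])"
    by (rule singular_relboundary_diff[OF singular_relboundary_add[OF singular_relboundary_add[OF X Y(1)] Y(2)] Y(3)])
  then show "homologous_rel 3 W ?S (F [b,a,c,d]) (- F [a,b,c,d])"
    by (simp add: homologous_rel_def algebra_simps)
  have X: "singular_relboundary 3 W ?S (F [b,c,b,d] - F [a,c,b,d] + F [a,b,b,d] - F [a,b,c,d] + F [a,b,c,b])"
    using bd[of "tet_vertex a" "tet_vertex b" "tet_vertex c" "tet_vertex b" "tet_vertex d"] vx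
    by (simp add: F_def)
  have Y: "singular_relboundary 3 W ?S (F [b,c,b,d])" "singular_relboundary 3 W ?S (F [a,b,b,d])"
      "singular_relboundary 3 W ?S (F [a,b,c,b])"
    using dg[of b c b d a] dg[of a b b d c] dg[of a b c b d] le dist by auto
  have "singular_relboundary 3 W ?S (F [b,c,b,d] + F [a,b,b,d] + F [a,b,c,b]
     - (F [b,c,b,d] - F [a,c,b,d] + F [a,b,b,d] - F [a,b,c,d] + F [a,b,c,b]))"
    by (rule singular_relboundary_diff[OF singular_relboundary_add[OF singular_relboundary_add[OF Y(1) Y(2)] Y(3)] X])
  then show "homologous_rel 3 W ?S (F [a,c,b,d]) (- F [a,b,c,d])"
    by (simp add: homologous_rel_def algebra_simps)
  have X: "singular_relboundary 3 W ?S (F [b,c,d,c] - F [a,c,d,c] + F [a,b,d,c] - F [a,b,c,c] + F [a,b,c,d])"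
    using bd[of "tet_vertex a" "tet_vertex b" "tet_vertex c" "tet_vertex d" "tet_vertex c"] vx
    by (simp add: F_def)
  have Y: "singular_relboundary 3 W ?S (F [b,c,d,c])" "singular_relboundary 3 W ?S (F [a,c,d,c])"
      "singular_relboundary 3 W ?S (F [a,b,c,c])"
    using dg[of b c d c a] dg[of a c d c b] dg[of a b c c d] le dist by auto
  have "singular_relboundary 3 W ?S ((F [b,c,d,c] - F [a,c,d,c] + F [a,b,d,c] - F [a,b,c,c] + F [a,b,c,d])
      + F [a,c,d,c] + F [a,b,c,c] - F [b,c,d,c])"
    by (rule singular_relboundary_diff[OF singular_relboundary_add[OF singular_relboundary_add[OF X Y(2)] Y(3)] Y(1)])
  then show "homologous_rel 3 W ?S (F [a,b,d,c]) (- F [a,b,c,d])"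
    by (simp add: homologous_rel_def algebra_simps)
qed

definition tet_center :: "nat \<Rightarrow> real" where
  "tet_center = (\<lambda>j. if j \<le> 3 then 1/4 else 0)"

lemma tet_center_in_simplex: "tet_center \<in> standard_simplex 3"
  by (simp add: tet_center_def standard_simplex_def eval_nat_numeral)

text \<open>Subdividing the tetrahedron at its barycentre does not change the class at a point of the part
adjacent to the face \<open>pqs\<close>. That part consists of the points whose smallest barycentric coordinate
is the one of \<open>r\<close>; each of the three other parts has a coordinate of \<open>p\<close>, \<open>q\<close> or \<open>s\<close> that is at most that of
\<open>r\<close>. The homology is the boundary of the simplex with vertices \<open>p, q, s, c, r\<close>, where \<open>c\<close> is the
barycentre.\<close>

lemma affine_cone:
  assumes g: "continuous_map (subtopology (powertop_real UNIV) (standard_simplex 3)) W g"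
    and vs: "{p,q,s,r} = {..3::nat}"
    and y: "\<And>x. x \<in> standard_simplex 3 \<Longrightarrow> g x = y \<Longrightarrow> x r < x p \<and> x r < x q \<and> x r < x s"
  shows "homologous_rel 3 W (topspace W - {y})
      (frag_of (affine_simplex g [tet_vertex p, tet_vertex q, tet_vertex s, tet_center]))
      (frag_of (affine_simplex g (map tet_vertex [p,q,s,r])))"
proof -
  let ?S = "topspace W - {y}"
  let ?v = tet_vertex
  let ?F = "\<lambda>vs. frag_of (affine_simplex g vs)"
  have le: "p \<le> 3" "q \<le> 3" "s \<le> 3" "r \<le> 3" using vs by auto
  have "card {p,q,s,r} = 4" using vs by simp
  then have dist: "distinct [p,q,s,r]" by (intro card_distinct) simp
  have vx: "{?v p, ?v q, ?v s, ?v r, tet_center} \<subseteq> standard_simplex 3"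
    using le by (auto intro: tet_vertex_in_simplex tet_center_in_simplex)
  have av: "singular_relboundary 3 W ?S (?F [?v a, ?v b, tet_center, ?v r])"
    if ab: "{a,b,c} = {p,q,s}" "distinct [a,b,c]" for a b c
  proof (intro singular_chain_imp_relboundary chain_avoids_point[OF g])
    have cr: "c \<le> 3" "c \<in> {p,q,s}" "c \<noteq> r" "a \<noteq> c" "b \<noteq> c" "a \<noteq> r" "b \<noteq> r" using ab le dist by auto
    fix x assume x: "x \<in> vertex_hull [?v a, ?v b, tet_center, ?v r]" "x \<in> standard_simplex 3"
    obtain \<alpha> \<beta> \<gamma> \<delta> where "0 \<le> \<delta>"
      "x = (\<lambda>i. ?v a i * \<alpha> + ?v b i * \<beta> + tet_center i * \<gamma> + ?v r i * \<delta>)"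
      using x(1) by (rule vertex_hull_4)
    then have "x c \<le> x r" using cr le by (simp add: tet_vertex_def tet_center_def)
    then show "g x \<noteq> y" using y[OF x(2)] cr by auto
  next
    have "a \<in> {p,q,s}" "b \<in> {p,q,s}" using ab by auto
    then show "set [?v a, ?v b, tet_center, ?v r] \<subseteq> standard_simplex 3" using vx by auto
  qed simp
  have X: "singular_relboundary 3 W ?S (?F [?v q, ?v s, tet_center, ?v r] - ?F [?v p, ?v s, tet_center, ?v r]
     + ?F [?v p, ?v q, tet_center, ?v r] - ?F [?v p, ?v q, ?v s, ?v r] + ?F [?v p, ?v q, ?v s, tet_center])"
    using relboundary_affine_4[OF g, where S = ?S, of "?v p" "?v q" "?v s" tet_center "?v r"] vx by auto
  have Y: "singular_relboundary 3 W ?S (?F [?v q, ?v s, tet_center, ?v r])"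
     "singular_relboundary 3 W ?S (?F [?v p, ?v s, tet_center, ?v r])"
     "singular_relboundary 3 W ?S (?F [?v p, ?v q, tet_center, ?v r])"
    using av[of q s p] av[of p s q] av[of p q s] dist by auto
  have "singular_relboundary 3 W ?S ((?F [?v q, ?v s, tet_center, ?v r] - ?F [?v p, ?v s, tet_center, ?v r]
     + ?F [?v p, ?v q, tet_center, ?v r] - ?F [?v p, ?v q, ?v s, ?v r] + ?F [?v p, ?v q, ?v s, tet_center])
    + ?F [?v p, ?v s, tet_center, ?v r] - ?F [?v p, ?v q, tet_center, ?v r] - ?F [?v q, ?v s, tet_center, ?v r])"
    by (rule singular_relboundary_diff[OF singular_relboundary_diff[OF singular_relboundary_add[OF X Y(2)] Y(3)] Y(1)])
  then show ?thesis by (simp add: homologous_rel_def algebra_simps)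
qed

section \<open>Points identified in a triangulation\<close>

lemma quo_continuous:
  fixes T :: "('i, 'w) triang"
  assumes "triangulation W ori T" "i \<in> tets T"
  shows "continuous_map (subtopology (powertop_real UNIV) (standard_simplex 3)) W (\<lambda>x. quo T (i, x))"
proof -
  let ?X = "\<lambda>_::'i. subtopology (powertop_real UNIV) (standard_simplex 3)"
  have "continuous_map (sum_topology ?X (tets T)) W (quo T)"
    using assms(1) by (simp add: triangulation_def quotient_imp_continuous_map)
  moreover have "continuous_map (subtopology (powertop_real UNIV) (standard_simplex 3)) (sum_topology ?X (tets T)) (\<lambda>x. (i,x))"
    using continuous_map_component_injection[OF assms(2), of ?X] by simp
  ultimately have "continuous_map (subtopology (powertop_real UNIV) (standard_simplex 3)) W (quo T \<circ> (\<lambda>x. (i, x)))"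
    by (rule continuous_map_compose[rotated])
  then show ?thesis by (simp add: comp_def)
qed

lemma quo_eq_iff:
  assumes "triangulation W ori T" "i \<in> tets T" "x \<in> standard_simplex 3" "j \<in> tets T" "y \<in> standard_simplex 3"
  shows "quo T (i, x) = quo T (j, y) \<longleftrightarrow> equivclp (point_id T) (i, x) (j, y)"
  using assms by (auto simp: triangulation_def)

lemma face_pairingD:
  assumes "face_pairing T" "i \<in> tets T" "r \<le> 3" "mate T (i, r) = (j, t)"
  shows "j \<in> tets T" "t \<le> 3" "(j, t) \<noteq> (i, r)" "mate T (j, t) = (i, r)"
    "bij_betw (glue T (i, r)) ({..3} - {r}) ({..3} - {t})"
    "\<And>v. v \<le> 3 \<Longrightarrow> v \<noteq> r \<Longrightarrow> glue T (j, t) (glue T (i, r) v) = v"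
    "\<And>v. v \<le> 3 \<Longrightarrow> v \<noteq> t \<Longrightarrow> glue T (i, r) (glue T (j, t) v) = v"
    "\<And>v. v \<le> 3 \<Longrightarrow> v \<noteq> r \<Longrightarrow> glue T (i, r) v \<le> 3 \<and> glue T (i, r) v \<noteq> t"
    "\<And>v. v \<le> 3 \<Longrightarrow> v \<noteq> t \<Longrightarrow> glue T (j, t) v \<le> 3 \<and> glue T (j, t) v \<noteq> r"
proof -
  have f: "(i, r) \<in> abs_faces T" using assms by (auto simp: abs_faces_def)
  have P: "mate T f \<in> abs_faces T \<and> mate T f \<noteq> f \<and> mate T (mate T f) = f \<and>
        bij_betw (glue T f) ({..3} - {snd f}) ({..3} - {snd (mate T f)}) \<and>
        (\<forall>v\<in>{..3} - {snd f}. glue T (mate T f) (glue T f v) = v)" if "f \<in> abs_faces T" for f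
    using assms(1) that by (auto simp: face_pairing_def)
  note A = P[OF f, unfolded assms(4)]
  have f': "(j, t) \<in> abs_faces T" using A by auto
  then show "j \<in> tets T" "t \<le> 3" by (auto simp: abs_faces_def)
  show m: "mate T (j, t) = (i, r)" "(j, t) \<noteq> (i, r)" using A by auto
  note B = P[OF f', unfolded m]
  show "bij_betw (glue T (i, r)) ({..3} - {r}) ({..3} - {t})" using A by auto
  then show "glue T (i, r) v \<le> 3 \<and> glue T (i, r) v \<noteq> t" if "v \<le> 3" "v \<noteq> r" for v
    using that bij_betw_apply by fastforce
  have "bij_betw (glue T (j, t)) ({..3} - {t}) ({..3} - {r})" using B by auto
  then show "glue T (j, t) v \<le> 3 \<and> glue T (j, t) v \<noteq> r" if "v \<le> 3" "v \<noteq> t" for v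
    using that bij_betw_apply by fastforce
  show "glue T (j, t) (glue T (i, r) v) = v" if "v \<le> 3" "v \<noteq> r" for v using A that by auto
  show "glue T (i, r) (glue T (j, t) v) = v" if "v \<le> 3" "v \<noteq> t" for v using B that by auto
qed

lemma point_id_sym:
  assumes T: "face_pairing T" and s: "point_id T s t"
  shows "point_id T t s"
proof -
  obtain k l where k: "(fst s, k) \<in> abs_faces T" "mate T (fst s, k) = (fst t, l)"
        "snd s k = 0" "snd t l = 0"
    and e: "\<And>v. v\<in>{..3} - {k} \<Longrightarrow> snd t (glue T (fst s, k) v) = snd s v"
    and st: "snd s \<in> standard_simplex 3" "snd t \<in> standard_simplex 3"
    using s unfolding point_id_def by blast
  note D = face_pairingD[OF T _ _ k(2)]
  have ik: "fst s \<in> tets T" "k \<le> 3" using k(1) by (auto simp: abs_faces_def)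
  have "snd s (glue T (fst t, l) v) = snd t v" if v: "v \<in> {..3} - {l}" for v
  proof -
    have "glue T (fst t, l) v \<in> {..3} - {k}" using D(9)[OF ik, of v] v by auto
    from e[OF this] show ?thesis using D(7)[OF ik, of v] v by auto
  qed
  then show ?thesis unfolding point_id_def
    using st k D(1,2,4)[OF ik] ik by (intro conjI exI[of _ l] exI[of _ k]) (auto simp: abs_faces_def)
qed

definition open_face :: "nat \<Rightarrow> (nat \<Rightarrow> real) set" where
  "open_face k = {x \<in> standard_simplex 3. x k = 0 \<and> (\<forall>v\<le>3. v \<noteq> k \<longrightarrow> 0 < x v)}"

text \<open>An identification of points needs a vanishing barycentric coordinate.\<close>

lemma quo_interior_inj:
  assumes T: "triangulation W ori T" and "i \<in> tets T" "x \<in> open_tet" "j \<in> tets T" "y \<in> standard_simplex 3"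
    and eq: "quo T (j, y) = quo T (i, x)"
  shows "j = i \<and> y = x"
proof -
  have fp: "face_pairing T" using T by (simp add: triangulation_def)
  have xs: "x \<in> standard_simplex 3" using assms by (auto simp: open_tet_def)
  have no: "\<not> point_id T (i, x) t" for t
    using assms(3) by (auto simp: point_id_def abs_faces_def open_tet_def)
  have "t = (i, x)" if "equivclp (point_id T) (i, x) t" for t
    using that by (induction rule: equivclp_induct) (use no point_id_sym[OF fp] in blast)+
  moreover have "equivclp (point_id T) (i, x) (j, y)"
    using eq quo_eq_iff[OF T assms(2) xs assms(4,5)] by simp
  ultimately show ?thesis by blast
qed

text \<open>A point with exactly one vanishing coordinate lies in one face only, and the identifications
preserve the coordinates; so its whole class consists of such points. The edges, and the points
inside the tetrahedra, thus stay away from it.\<close>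

lemma quo_open_face:
  assumes T: "triangulation W ori T" and i: "i \<in> tets T" and k: "k \<le> 3" and x: "x \<in> open_face k"
    and j: "j \<in> tets T" and y: "y \<in> standard_simplex 3"
    and eq: "quo T (j, y) = quo T (i, x)"
  shows "\<exists>l\<le>3. y \<in> open_face l"
proof -
  have fp: "face_pairing T" using T by (simp add: triangulation_def)
  have xs: "x \<in> standard_simplex 3" using x by (auto simp: open_face_def)
  have move: "\<exists>l\<le>3. snd b \<in> open_face l" if pid: "point_id T a b" and a: "\<exists>k\<le>3. snd a \<in> open_face k" for a b
  proof -
    obtain k l where k: "(fst a, k) \<in> abs_faces T" "mate T (fst a, k) = (fst b, l)"
        "snd a k = 0" "snd b l = 0"
      and e: "\<And>v. v\<in>{..3} - {k} \<Longrightarrow> snd b (glue T (fst a, k) v) = snd a v"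
      and st: "snd a \<in> standard_simplex 3" "snd b \<in> standard_simplex 3"
      using pid unfolding point_id_def by blast
    have ik: "fst a \<in> tets T" "k \<le> 3" using k(1) by (auto simp: abs_faces_def)
    note D = face_pairingD[OF fp ik k(2)]
    have a': "0 < snd a v" if "v \<le> 3" "v \<noteq> k" for v
      using a k(3) ik that unfolding open_face_def by (metis (mono_tags, lifting) less_irrefl mem_Collect_eq)
    have "0 < snd b v" if v: "v \<le> 3" "v \<noteq> l" for v
      using a'[of "glue T (fst b, l) v"] e[of "glue T (fst b, l) v"] D(7,9)[OF v] by auto
    then show ?thesis using st k D(2) by (auto simp: open_face_def)
  qed
  have "equivclp (point_id T) (i, x) (j, y)"
    using eq quo_eq_iff[OF T i xs j y] by simp
  then have "\<exists>l\<le>3. snd (j, y) \<in> open_face l"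
  proof (induction rule: equivclp_induct)
    case base then show ?case using x k by auto
  next
    case (step a b)
    then show ?case using move point_id_sym[OF fp] by blast
  qed
  then show ?thesis by simp
qed

section \<open>Orderings of the vertices and local orientations\<close>

definition pair_sign :: "nat \<Rightarrow> nat \<Rightarrow> int" where
  "pair_sign a b = sgn (int b - int a)"

lemma pair_sign_swap: "pair_sign b a = - pair_sign a b"
  by (simp add: pair_sign_def sgn_if)

text \<open>For distinct arguments, this is the sign of the permutation that sorts them, given as the sign
of their Vandermonde determinant. In this form an exchange of neighbours negates one factor and permutes
the others.\<close>

definition perm_sign :: "nat \<Rightarrow> nat \<Rightarrow> nat \<Rightarrow> nat \<Rightarrow> int" where
  "perm_sign a b c d = pair_sign a b * pair_sign a c * pair_sign a d * pair_sign b c * pair_sign b d * pair_sign c d"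

lemma perm_sign_swap:
  "perm_sign b a c d = - perm_sign a b c d"
  "perm_sign a c b d = - perm_sign a b c d"
  "perm_sign a b d c = - perm_sign a b c d"
  unfolding perm_sign_def pair_sign_swap[of b a] pair_sign_swap[of c b] pair_sign_swap[of d c]
  by (simp_all only: mult_minus_left mult_minus_right mult_ac)

lemma perm_sign_cases:
  assumes "distinct [a,b,c,d]"
  shows "perm_sign a b c d = 1 \<or> perm_sign a b c d = -1"
proof -
  have "\<bar>pair_sign x y\<bar> = 1" if "x \<noteq> y" for x y using that by (simp add: pair_sign_def sgn_if)
  then have "\<bar>perm_sign a b c d\<bar> = 1" using assms by (simp add: perm_sign_def abs_mult)
  then show ?thesis by linarith
qed

lemma four_points:
  assumes "{a,b,c,d} = {..3::nat}"
  shows "distinct [a,b,c,d]" "a \<le> 3" "b \<le> 3" "c \<le> 3" "d \<le> 3"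
proof -
  have "card {a,b,c,d} = 4" using assms by simp
  then show "distinct [a,b,c,d]" by (intro card_distinct) simp
  show "a \<le> 3" "b \<le> 3" "c \<le> 3" "d \<le> 3" using assms by auto
qed

lemma le_3_cases: "v = 0 \<or> v = 1 \<or> v = 2 \<or> v = 3" if "v \<le> 3" for v :: nat
  using that by auto

text \<open>The symmetric group on four letters is generated by the exchanges of neighbours.\<close>

lemma four_points_induct:
  assumes base: "P 0 1 2 3"
    and s: "\<And>a b c d. P a b c d \<Longrightarrow> P b a c d" "\<And>a b c d. P a b c d \<Longrightarrow> P a c b d" "\<And>a b c d. P a b c d \<Longrightarrow> P a b d c"
    and vs: "{a,b,c,d} = {..3::nat}"
  shows "P a b c d"
proof -
  have e: "P a b c d = P b a c d" "P a b c d = P a c b d" "P a b c d = P a b d c" for a b c d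
    using s by blast+
  note D = four_points[OF vs]
  show "P a b c d"
    using le_3_cases[OF D(2)] le_3_cases[OF D(3)] le_3_cases[OF D(4)] le_3_cases[OF D(5)] D(1) base
    by (elim disjE; simp del: One_nat_def; simp only: e)
qed

text \<open>The vertex ordering \<open>vs\<close> represents \<open>\<epsilon>\<close> times the orientation of \<open>W\<close> at the interior points of the
tetrahedron.\<close>

definition oriented_by ::
  "'w topology \<Rightarrow> ('w \<Rightarrow> 'w chain set) \<Rightarrow> ('i, 'w) triang \<Rightarrow> 'i \<Rightarrow> nat list \<Rightarrow> int \<Rightarrow> bool" where
  "oriented_by W ori T i vs \<epsilon> \<longleftrightarrow> (\<forall>x\<in>open_tet. ori (quo T (i, x)) =
     homologous_rel_set 3 W (topspace W - {quo T (i, x)})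
        (frag_cmul \<epsilon> (frag_of (affine_simplex (\<lambda>x. quo T (i, x)) (map tet_vertex vs)))))"

lemma interior_point_preimages:
  assumes "triangulation W ori T" "i \<in> tets T" "x \<in> open_tet"
  shows "only_interior_preimages (\<lambda>x. quo T (i, x)) (quo T (i, x))"
  using quo_interior_inj[OF assms(1-3) assms(2)] assms(3) by blast

lemma oriented_by_swap:
  assumes T: "triangulation W ori T" "i \<in> tets T" and vs: "{a,b,c,d} = {..3::nat}"
    and o: "oriented_by W ori T i [a,b,c,d] \<epsilon>"
  shows "oriented_by W ori T i [b,a,c,d] (- \<epsilon>)" "oriented_by W ori T i [a,c,b,d] (- \<epsilon>)"
    "oriented_by W ori T i [a,b,d,c] (- \<epsilon>)"
proof -
  let ?F = "\<lambda>vs. frag_of (affine_simplex (\<lambda>x. quo T (i, x)) (map tet_vertex vs))"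
  have "homologous_rel_set 3 W (topspace W - {y}) (frag_cmul \<epsilon> (?F [a,b,c,d]))
      = homologous_rel_set 3 W (topspace W - {y}) (frag_cmul (-\<epsilon>) G)"
    if "homologous_rel 3 W (topspace W - {y}) G (- ?F [a,b,c,d])" for G y
    unfolding homologous_rel_set_eq
    using homologous_rel_cmul[OF that, of "-\<epsilon>"]
    by (subst homologous_rel_sym) (simp add: frag_cmul_uminus)
  note * = this[OF affine_swap(1)[OF quo_continuous[OF T] interior_point_preimages[OF T] vs]]
    this[OF affine_swap(2)[OF quo_continuous[OF T] interior_point_preimages[OF T] vs]]
    this[OF affine_swap(3)[OF quo_continuous[OF T] interior_point_preimages[OF T] vs]]
  show "oriented_by W ori T i [b,a,c,d] (- \<epsilon>)" "oriented_by W ori T i [a,c,b,d] (- \<epsilon>)"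
    "oriented_by W ori T i [a,b,d,c] (- \<epsilon>)"
    using o * unfolding oriented_by_def by simp_all
qed

lemma affine_simplex_tet_relcycle:
  assumes T: "triangulation W ori T" "i \<in> tets T" and x: "x \<in> open_tet" and vs: "set [a,b,c,d] \<subseteq> {..3}"
  shows "singular_relcycle 3 W (topspace W - {quo T (i, x)})
     (frag_of (affine_simplex (\<lambda>x. quo T (i, x)) (map tet_vertex [a,b,c,d])))"
proof -
  let ?g = "\<lambda>x. quo T (i, x)" let ?S = "topspace W - {?g x}"
  note g = quo_continuous[OF T]
  have ff: "only_interior_preimages ?g (?g x)" by (rule interior_point_preimages[OF T x])
  have f: "singular_chain 2 (subtopology W ?S) (frag_of (affine_simplex ?g (map tet_vertex [a',b',c'])))"
    if s: "set [a',b',c'] \<subseteq> {..3}" for a' b' c'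
  proof (rule chain_avoids_point[OF g])
    fix z assume z: "z \<in> vertex_hull (map tet_vertex [a',b',c'])" "z \<in> standard_simplex 3"
    obtain \<alpha> \<beta> \<gamma> where e: "z = (\<lambda>i. tet_vertex a' i * \<alpha> + tet_vertex b' i * \<beta> + tet_vertex c' i * \<gamma>)"
      using z(1) by (auto elim: vertex_hull_3)
    have "card {a',b',c'} \<le> 3" by (rule card_insert_le_m1 | simp)+
    then have "\<not> {..3::nat} \<subseteq> {a',b',c'}" using card_mono[of "{a',b',c'}" "{..3::nat}"] by auto
    then obtain v where v: "v \<le> 3" "v \<notin> {a',b',c'}" by auto
    then have "z v = 0" using e by (simp add: tet_vertex_def)
    then have "z \<notin> open_tet" using v by (auto simp: open_tet_def)
    then show "?g z \<noteq> ?g x" using ff z by blast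
  qed (use s in \<open>auto intro: tet_vertex_in_simplex\<close>)
  have "singular_simplex (length (map tet_vertex [a,b,c,d]) - 1) (subtopology W (topspace W))
     (affine_simplex ?g (map tet_vertex [a,b,c,d]))"
    using vs vertex_hull_subset_simplex[of "map tet_vertex [a,b,c,d]" 3] continuous_map_image_subset_topspace[OF g]
      tet_vertex_in_simplex
    by (intro singular_simplex_affine_simplex[OF g]) auto
  then have 1: "singular_chain 3 W (frag_of (affine_simplex ?g (map tet_vertex [a,b,c,d])))"
    by (simp add: singular_chain_of eval_nat_numeral)
  have "singular_chain 2 (subtopology W ?S) (chain_boundary 3 (frag_of (affine_simplex ?g (map tet_vertex [a,b,c,d]))))"
    using f[of b c d] f[of a c d] f[of a b d] f[of a b c] vs
    by (simp add: chain_boundary_affine_3 singular_chain_add singular_chain_diff)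
  with 1 show ?thesis by (simp add: singular_relcycle)
qed

lemma oriented_simplex_tet_vertex:
  assumes "x \<in> standard_simplex 3"
  shows "oriented_simplex 3 tet_vertex x = x"
  unfolding oriented_simplex_def restrict_def using assms
proof (simp, intro ext)
  fix i
  show "(\<Sum>j\<le>3. tet_vertex j i * x j) = x i"
  proof (cases "i \<le> 3")
    case True
    have "(\<Sum>j\<le>3. tet_vertex j i * x j) = (\<Sum>j\<le>3. if j = i then x j else 0)"
      by (rule sum.cong) (auto simp: tet_vertex_def)
    then show ?thesis using True by simp
  next
    case False
    then have "(\<Sum>j\<le>3. tet_vertex j i * x j) = 0"
      by (intro sum.neutral) (auto simp: tet_vertex_def)
    then show ?thesis using False assms by (auto simp: standard_simplex_def)
  qed
qed

lemma tet_simplex_eq_affine: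
  "tet_simplex T i s = affine_simplex (\<lambda>x. quo T (i, x)) (map tet_vertex [s 0, s 1, s 2, s 3])"
proof -
  have "oriented_simplex 3 (\<lambda>m. tet_vertex (s m)) = oriented_simplex 3 (\<lambda>j. map tet_vertex [s 0, s 1, s 2, s 3] ! j)"
    by (subst oriented_simplex_eq) (auto simp: le_Suc_eq eval_nat_numeral)
  then show ?thesis by (simp add: tet_simplex_def affine_simplex_def eval_nat_numeral)
qed

text \<open>The number \<open>tor T i\<close> is by definition the sign for the ordering \<open>0, 1, 2, 3\<close>, and each exchange of
neighbours changes the sign.\<close>

lemma oriented_by_perm_sign:
  assumes T: "triangulation W ori T" "i \<in> tets T" and vs: "{a,b,c,d} = {..3}"
  shows "oriented_by W ori T i [a,b,c,d] (tor T i * perm_sign a b c d)"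
proof -
  define Q where "Q = (\<lambda>a b c d. {a,b,c,d} = {..3} \<longrightarrow> oriented_by W ori T i [a,b,c,d] (tor T i * perm_sign a b c d))"
  have Q0: "Q 0 1 2 3"
  proof -
    have "ori (quo T (i, x)) = homologous_rel_set 3 W (topspace W - {quo T (i, x)})
        (frag_cmul (tor T i) (frag_of (affine_simplex (\<lambda>x. quo T (i, x)) (map tet_vertex [0,1,2,3]))))"
      if x: "x \<in> open_tet" for x
    proof -
      have xs: "x \<in> standard_simplex 3" using x by (auto simp: open_tet_def)
      have e: "tet_simplex T i id x = quo T (i, x)"
        using oriented_simplex_tet_vertex[OF xs] xs by (simp add: tet_simplex_def simplex_map_def)
      have "ori (quo T (i, x)) = local_class W (tet_simplex T i id) x
             [^]\<^bsub>relative_homology_group (int 3) W (topspace W - {quo T (i, x)})\<^esub> tor T i"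
      proof -
        have "\<forall>i\<in>tets T. \<forall>x\<in>open_tet. local_class W (tet_simplex T i id) x
             [^]\<^bsub>relative_homology_group 3 W (topspace W - {tet_simplex T i id x})\<^esub> tor T i
           = ori (tet_simplex T i id x)" using T(1) unfolding triangulation_def by blast
        from this[rule_format, OF T(2) x] show ?thesis by (simp add: e)
      qed
      also have "\<dots> = homologous_rel_set 3 W (topspace W - {quo T (i, x)})
          (frag_cmul (tor T i) (frag_of (affine_simplex (\<lambda>x. quo T (i, x)) (map tet_vertex [0,1,2,3]))))"
        unfolding local_class_def e unfolding tet_simplex_eq_affine id_apply
        by (rule int_pow_homology_class[OF affine_simplex_tet_relcycle[OF T x]]) auto
      finally show ?thesis .
    qed
    moreover have "perm_sign 0 1 2 3 = 1" by (simp add: perm_sign_def pair_sign_def)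
    ultimately show ?thesis by (simp add: Q_def oriented_by_def)
  qed
  have s1: "Q a b c d \<Longrightarrow> Q b a c d" and s2: "Q a b c d \<Longrightarrow> Q a c b d" and s3: "Q a b c d \<Longrightarrow> Q a b d c" for a b c d
    unfolding Q_def perm_sign_swap(1)[of b a c d] perm_sign_swap(2)[of a c b d] perm_sign_swap(3)[of a b d c]
    using oriented_by_swap[OF T, of a b c d] by (auto simp: insert_commute)
  have "Q a b c d" by (rule four_points_induct[of Q, OF Q0 s1 s2 s3 vs])
  then show ?thesis using vs by (simp add: Q_def)
qed

section \<open>Face identifications reverse the orientation\<close>

text \<open>Used to find interior points of a tetrahedron close to the centre of one of its faces, on the
segment to the barycentre.\<close>

lemma segment_enters_open:
  assumes g: "continuous_map (subtopology (powertop_real UNIV) (standard_simplex 3)) W g"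
    and N: "openin W N" "g a \<in> N" and a: "a \<in> standard_simplex 3" and c: "c \<in> standard_simplex 3"
  obtains u :: real where "0 < u" "u < 1" "g (\<lambda>i. (1 - u) * a i + u * c i) \<in> N"
proof -
  let ?h = "\<lambda>u i. (1 - u) * a i + u * c i :: real"
  have "continuous_map (subtopology euclideanreal {0..1}) (powertop_real UNIV) ?h"
    unfolding continuous_map_componentwise by (force intro: continuous_intros)
  moreover have "?h u \<in> standard_simplex 3" if "u \<in> {0..1}" for u
    using that a c by (auto intro: convex_standard_simplex)
  ultimately have "continuous_map (subtopology euclideanreal {0..1})
       (subtopology (powertop_real UNIV) (standard_simplex 3)) ?h"
    by (auto simp: continuous_map_in_subtopology)
  from continuous_map_compose[OF this g]
  have "openin (subtopology euclideanreal {0..1}) {u \<in> {0..1}. g (?h u) \<in> N}"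
    using openin_continuous_map_preimage[OF _ N(1)] by (fastforce simp: comp_def)
  moreover have "0 \<in> {u \<in> {0..1}. g (?h u) \<in> N}" using N by simp
  ultimately obtain e where e: "0 < e" "ball 0 e \<inter> {0..1} \<subseteq> {u \<in> {0..1}. g (?h u) \<in> N}"
    unfolding openin_contains_ball by (metis (no_types, lifting))
  let ?u = "min (1/2) (e/2)"
  have "?u \<in> ball 0 e \<inter> {0..1}" using e(1) by auto
  then have "g (?h ?u) \<in> N" using e(2) by blast
  then show thesis using e(1) by (intro that[of ?u]) auto
qed

definition face_center :: "nat \<Rightarrow> nat \<Rightarrow> real" where
  "face_center k = (\<lambda>v. if v \<le> 3 \<and> v \<noteq> k then 1/3 else 0)"

definition near_face :: "nat \<Rightarrow> real \<Rightarrow> nat \<Rightarrow> real" where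
  "near_face k u = (\<lambda>v. (1 - u) * face_center k v + u * tet_center v)"

lemma face_center_open_face:
  assumes "k \<le> 3" shows "face_center k \<in> open_face k"
proof -
  have "(\<Sum>v\<le>3. face_center k v) = (\<Sum>v\<in>{..3}-{k}. 1/3)"
    by (rule sum.mono_neutral_cong_right) (auto simp: face_center_def)
  also have "\<dots> = 1" using assms by simp
  finally show ?thesis by (auto simp: open_face_def standard_simplex_def face_center_def)
qed

lemma near_face:
  assumes "k \<le> 3" "0 < u" "u < 1"
  shows "near_face k u \<in> open_tet" "\<And>v. v \<le> 3 \<Longrightarrow> v \<noteq> k \<Longrightarrow> near_face k u k < near_face k u v"
proof -
  have "near_face k u \<in> standard_simplex 3"
    unfolding near_face_def using assms face_center_open_face[OF assms(1)]
    by (intro convex_standard_simplex tet_center_in_simplex) (auto simp: open_face_def)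
  then show "near_face k u \<in> open_tet"
    using assms by (auto simp: open_tet_def near_face_def face_center_def tet_center_def add_pos_pos)
  show "near_face k u k < near_face k u v" if "v \<le> 3" "v \<noteq> k" for v
    using assms that by (simp add: near_face_def face_center_def tet_center_def)
qed

lemma quo_glue:
  assumes T: "triangulation W ori T" and i: "i \<in> tets T" and r: "r \<le> 3" and m: "mate T (i, r) = (j, t)"
    and x: "x \<in> standard_simplex 3" "x r = 0" and y: "y \<in> standard_simplex 3" "y t = 0"
    and e: "\<And>v. v \<le> 3 \<Longrightarrow> v \<noteq> r \<Longrightarrow> y (glue T (i, r) v) = x v"
  shows "quo T (i, x) = quo T (j, y)"
proof -
  have j: "j \<in> tets T" using face_pairingD(1)[OF _ i r m] T by (simp add: triangulation_def)
  have "point_id T (i, x) (j, y)" unfolding point_id_def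
    using x y e m i r by (intro conjI exI[of _ r] exI[of _ t]) (auto simp: abs_faces_def)
  then show ?thesis using quo_eq_iff[OF T i x(1) j y(1)] by (meson r_into_equivclp)
qed

lemma triangle_coords:
  assumes "distinct [a, b, c]"
  shows "(\<Sum>j\<le>2. ([tet_vertex a, tet_vertex b, tet_vertex c] ! j) a * x j) = x 0"
    "(\<Sum>j\<le>2. ([tet_vertex a, tet_vertex b, tet_vertex c] ! j) b * x j) = x 1"
    "(\<Sum>j\<le>2. ([tet_vertex a, tet_vertex b, tet_vertex c] ! j) c * x j) = x 2"
    "v \<notin> {a, b, c} \<Longrightarrow> (\<Sum>j\<le>2. ([tet_vertex a, tet_vertex b, tet_vertex c] ! j) v * x j) = 0"
proof -
  have e: "{..2::nat} = {0,1,2}" by auto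
  show "(\<Sum>j\<le>2. ([tet_vertex a, tet_vertex b, tet_vertex c] ! j) a * x j) = x 0"
    "(\<Sum>j\<le>2. ([tet_vertex a, tet_vertex b, tet_vertex c] ! j) b * x j) = x 1"
    "(\<Sum>j\<le>2. ([tet_vertex a, tet_vertex b, tet_vertex c] ! j) c * x j) = x 2"
    "v \<notin> {a, b, c} \<Longrightarrow> (\<Sum>j\<le>2. ([tet_vertex a, tet_vertex b, tet_vertex c] ! j) v * x j) = 0"
    using assms by (simp_all add: e tet_vertex_def)
qed

context
  fixes W :: "'w topology" and ori :: "'w \<Rightarrow> 'w chain set" and T :: "('i, 'w) triang"
    and i j :: 'i and p q s r p' q' s' t :: nat
  assumes T: "triangulation W ori T" and i: "i \<in> tets T"
    and vs: "{p,q,s,r} = {..3}" and m: "mate T (i, r) = (j, t)"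
    and g: "p' = glue T (i, r) p" "q' = glue T (i, r) q" "s' = glue T (i, r) s"
begin

abbreviation "face_cone k a b c \<equiv>
  frag_of (affine_simplex (\<lambda>x. quo T (k, x)) [tet_vertex a, tet_vertex b, tet_vertex c, tet_center])"

lemma glued_face:
  shows "r \<le> 3" "t \<le> 3" "j \<in> tets T" "{p',q',s',t} = {..3}" "mate T (j, t) = (i, r)" "(j, t) \<noteq> (i, r)"
    "p = glue T (j, t) p'" "q = glue T (j, t) q'" "s = glue T (j, t) s'"
proof -
  have fp: "face_pairing T" using T by (simp add: triangulation_def)
  note F = four_points[OF vs]
  note D = face_pairingD[OF fp i F(5) m]
  show "r \<le> 3" "t \<le> 3" "j \<in> tets T" "mate T (j, t) = (i, r)" "(j, t) \<noteq> (i, r)" using F D by auto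
  show "p = glue T (j, t) p'" "q = glue T (j, t) q'" "s = glue T (j, t) s'" using D(6) F g by auto
  have "{..3} - {r} = {p,q,s}" using vs F(1) by auto
  then have "{p',q',s'} = {..3} - {t}" using D(5) g by (auto simp: bij_betw_def)
  then show "{p',q',s',t} = {..3}" using D(2) by auto
qed

text \<open>Just inside the tetrahedron \<open>i\<close>, next to the face, only the first cone is seen, and it agrees there
with the whole tetrahedron. If \<open>j = i\<close>, the second cone stands on another face of \<open>i\<close> and stays where
the coordinate of \<open>t\<close> is minimal, whereas at the chosen points only the coordinate of \<open>r\<close> is.\<close>

lemma collar_cone:
  assumes u: "0 < u" "u < 1"
  defines "y \<equiv> quo T (i, near_face r u)"
  shows "homologous_rel 3 W (topspace W - {y}) (face_cone i p q s - face_cone j p' q' s')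
     (frag_of (affine_simplex (\<lambda>x. quo T (i, x)) (map tet_vertex [p,q,s,r])))"
proof -
  let ?S = "topspace W - {y}"
  note F = four_points[OF vs]
  note G = four_points[OF glued_face(4)]
  note n = near_face[OF glued_face(1) u]
  have 1: "homologous_rel 3 W ?S (face_cone i p q s) (frag_of (affine_simplex (\<lambda>x. quo T (i, x)) (map tet_vertex [p,q,s,r])))"
  proof (rule affine_cone[OF quo_continuous[OF T i] vs])
    fix x assume "x \<in> standard_simplex 3" "quo T (i, x) = y"
    then have "x = near_face r u" using quo_interior_inj[OF T i n(1) i] y_def by blast
    then show "x r < x p \<and> x r < x q \<and> x r < x s" using n(2) F by auto
  qed
  have "singular_chain 3 (subtopology W ?S) (face_cone j p' q' s')"
  proof (rule chain_avoids_point[OF quo_continuous[OF T glued_face(3)]])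
    fix z assume z: "z \<in> vertex_hull [tet_vertex p', tet_vertex q', tet_vertex s', tet_center]" "z \<in> standard_simplex 3"
    obtain \<alpha> \<beta> \<gamma> \<delta> where e: "0 \<le> \<alpha>" "0 \<le> \<beta>" "0 \<le> \<gamma>"
      "z = (\<lambda>i. tet_vertex p' i * \<alpha> + tet_vertex q' i * \<beta> + tet_vertex s' i * \<gamma> + tet_center i * \<delta>)"
      using z(1) by (auto elim: vertex_hull_4)
    have zt: "z t \<le> z r" using e G glued_face(1) by (simp add: tet_vertex_def tet_center_def)
    show "quo T (j, z) \<noteq> y"
    proof
      assume "quo T (j, z) = y"
      then have "j = i" "z = near_face r u"
        using quo_interior_inj[OF T i n(1) glued_face(3) z(2)] y_def by auto
      then show False using zt n(2)[of t] glued_face(2,6) by auto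
    qed
  qed (use G in \<open>auto intro: tet_vertex_in_simplex tet_center_in_simplex\<close>)
  then have "homologous_rel 3 W ?S (face_cone j p' q' s') 0"
    by (simp add: homologous_rel_def singular_chain_imp_relboundary)
  from homologous_rel_diff[OF 1 this] show ?thesis by simp
qed

text \<open>The bases of the two cones are the same singular 2-simplex of \<open>W\<close> and cancel in the boundary. The
other faces join an edge to a barycentre and do not meet the interior of any face.\<close>

lemma collar_relcycle:
  "singular_relcycle 3 W (topspace W - {quo T (i, face_center r)}) (face_cone i p q s - face_cone j p' q' s')"
proof -
  define X where "X = quo T (i, face_center r)"
  let ?S = "topspace W - {X}"
  note F = four_points[OF vs]
  note G = four_points[OF glued_face(4)]
  note fc = face_center_open_face[OF glued_face(1)]
  have av: "singular_chain 2 (subtopology W ?S)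
      (frag_of (affine_simplex (\<lambda>x. quo T (k, x)) [tet_vertex a, tet_vertex b, tet_center]))"
    if k: "k \<in> tets T" and ab: "a \<le> 3" "b \<le> 3" for k a b
  proof (rule chain_avoids_point[OF quo_continuous[OF T k]])
    fix z assume z: "z \<in> vertex_hull [tet_vertex a, tet_vertex b, tet_center]" "z \<in> standard_simplex 3"
    obtain \<alpha> \<beta> \<gamma> where e: "0 \<le> \<alpha>" "0 \<le> \<beta>" "0 \<le> \<gamma>"
      "z = (\<lambda>i. tet_vertex a i * \<alpha> + tet_vertex b i * \<beta> + tet_center i * \<gamma>)"
      using z(1) by (auto elim: vertex_hull_3)
    have "z \<notin> open_face l" if "l \<le> 3" for l
    proof
      assume zl: "z \<in> open_face l"
      have "z l \<ge> tet_center l * \<gamma>" using e by (simp add: tet_vertex_def)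
      then have "\<gamma> = 0" using zl e(3) that by (auto simp: open_face_def tet_center_def)
      have "card {a,b,l} \<le> 3" by (rule card_insert_le_m1 | simp)+
      then have "\<not> {..3::nat} \<subseteq> {a,b,l}" using card_mono[of "{a,b,l}" "{..3::nat}"] by auto
      then obtain v where v: "v \<le> 3" "v \<notin> {a,b,l}" by auto
      then have "z v = 0" using e \<open>\<gamma> = 0\<close> by (simp add: tet_vertex_def)
      then show False using zl v by (auto simp: open_face_def)
    qed
    then show "quo T (k, z) \<noteq> X"
      using quo_open_face[OF T i glued_face(1) fc k z(2)] X_def by blast
  qed (use ab in \<open>auto intro: tet_vertex_in_simplex tet_center_in_simplex\<close>)
  have tri: "affine_simplex (\<lambda>x. quo T (i, x)) [tet_vertex p, tet_vertex q, tet_vertex s]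
     = affine_simplex (\<lambda>x. quo T (j, x)) [tet_vertex p', tet_vertex q', tet_vertex s']"
  proof -
    have "quo T (i, \<lambda>v. \<Sum>j\<le>2. ([tet_vertex p, tet_vertex q, tet_vertex s] ! j) v * x j)
        = quo T (j, \<lambda>v. \<Sum>j\<le>2. ([tet_vertex p', tet_vertex q', tet_vertex s'] ! j) v * x j)"
      (is "quo T (i, ?x) = quo T (j, ?y)")
      if x: "x \<in> standard_simplex 2" for x
    proof (rule quo_glue[OF T i glued_face(1) m])
      have dp: "distinct [p, q, s]" and dq: "distinct [p', q', s']" using F(1) G(1) by auto
      have h: "?x \<in> vertex_hull [tet_vertex p, tet_vertex q, tet_vertex s]"
         "?y \<in> vertex_hull [tet_vertex p', tet_vertex q', tet_vertex s']"
        using x by (auto simp: vertex_hull_def numeral_2_eq_2)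
      show "?x \<in> standard_simplex 3" "?y \<in> standard_simplex 3"
        using h vertex_hull_subset_simplex[of "[tet_vertex p, tet_vertex q, tet_vertex s]" 3]
          vertex_hull_subset_simplex[of "[tet_vertex p', tet_vertex q', tet_vertex s']" 3] F G
        by (auto intro: tet_vertex_in_simplex)
      show "?x r = 0" "?y t = 0" using triangle_coords(4)[OF dp] triangle_coords(4)[OF dq] F(1) G(1) by auto
      show "?y (glue T (i, r) v) = ?x v" if v: "v \<le> 3" "v \<noteq> r" for v
      proof -
        consider "v = p" | "v = q" | "v = s" using v vs by auto
        then show ?thesis
        proof cases
          case 1
          show ?thesis unfolding 1 g(1)[symmetric] triangle_coords(1)[OF dp] triangle_coords(1)[OF dq] ..
        next
          case 2
          show ?thesis unfolding 2 g(2)[symmetric] triangle_coords(2)[OF dp] triangle_coords(2)[OF dq] ..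
        next
          case 3
          show ?thesis unfolding 3 g(3)[symmetric] triangle_coords(3)[OF dp] triangle_coords(3)[OF dq] ..
        qed
      qed
    qed
    then show ?thesis
      unfolding affine_simplex_def simplex_map_def oriented_simplex_def
      by (auto simp: fun_eq_iff restrict_def numeral_2_eq_2)
  qed
  have ch: "singular_chain 3 W (face_cone k a b c)" if k: "k \<in> tets T" and ab: "a \<le> 3" "b \<le> 3" "c \<le> 3" for k a b c
  proof -
    let ?l = "[tet_vertex a, tet_vertex b, tet_vertex c, tet_center]"
    have "set ?l \<subseteq> standard_simplex 3" using ab by (auto intro: tet_vertex_in_simplex tet_center_in_simplex)
    then have "singular_simplex (length ?l - 1) (subtopology W (topspace W)) (affine_simplex (\<lambda>x. quo T (k, x)) ?l)"
      using vertex_hull_subset_simplex[of ?l 3] continuous_map_image_subset_topspace[OF quo_continuous[OF T k]]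
      by (intro singular_simplex_affine_simplex[OF quo_continuous[OF T k]]) auto
    then show ?thesis by (simp add: singular_chain_of eval_nat_numeral)
  qed
  have "singular_chain 2 (subtopology W ?S) (chain_boundary 3 (face_cone i p q s - face_cone j p' q' s'))"
    unfolding chain_boundary_diff chain_boundary_affine_3 tri
    using av[OF i, of q s] av[OF i, of p s] av[OF i, of p q] av[OF glued_face(3), of q' s']
      av[OF glued_face(3), of p' s'] av[OF glued_face(3), of p' q'] F G
    by (simp add: singular_chain_add singular_chain_diff)
  moreover have "singular_chain 3 W (face_cone i p q s - face_cone j p' q' s')"
    using ch i glued_face(3) F G by (intro singular_chain_diff) auto
  ultimately show ?thesis by (simp add: singular_relcycle X_def)
qed

end

text \<open>Comparing with the degree \<open>n\<close> of the difference of the two cones at the centre \<open>X\<close> of the face, the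
sign of one side is \<open>n\<close> and that of the other side is \<open>-n\<close>.\<close>

lemma gluing_reverses_orientation:
  assumes W: "closed_oriented_3manifold W ori"
    and T: "triangulation W ori T" and i: "i \<in> tets T"
    and vs: "{p,q,s,r} = {..3}" and m: "mate T (i, r) = (j, t)"
    and g: "p' = glue T (i, r) p" "q' = glue T (i, r) q" "s' = glue T (i, r) s"
  shows "tor T j * perm_sign p' q' s' t = - (tor T i * perm_sign p q s r)"
proof -
  let ?cone = "\<lambda>k a b c. frag_of (affine_simplex (\<lambda>x. quo T (k, x)) [tet_vertex a, tet_vertex b, tet_vertex c, tet_center])"
  let ?F = "\<lambda>k vs. frag_of (affine_simplex (\<lambda>x. quo T (k, x)) (map tet_vertex vs))"
  define D where "D = ?cone i p q s - ?cone j p' q' s'"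
  define \<epsilon> where "\<epsilon> = tor T i * perm_sign p q s r"
  define \<epsilon>' where "\<epsilon>' = tor T j * perm_sign p' q' s' t"
  define X where "X = quo T (i, face_center r)"
  note GF = glued_face[OF T i vs m g]
  note GF' = glued_face[OF T GF(3,4,5) GF(7-9)]
  note fi = face_center_open_face[OF GF(1)] and fj = face_center_open_face[OF GF(2)]
  have inW: "quo T (k, x) \<in> topspace W" if "k \<in> tets T" "x \<in> standard_simplex 3" for k x
    using continuous_map_image_subset_topspace[OF quo_continuous[OF T that(1)]] that(2) by auto
  have fp: "face_pairing T" using T by (simp add: triangulation_def)
  have "X = quo T (j, face_center t)" unfolding X_def
    using fi fj face_pairingD(8)[OF fp i GF(1) m]
    by (intro quo_glue[OF T i GF(1) m]) (auto simp: open_face_def face_center_def)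
  have XW: "X \<in> topspace W" using fi inW[OF i] by (auto simp: X_def open_face_def)
  obtain U C where U: "openin W U" "X \<in> U"
    and C: "\<And>y. y \<in> U \<Longrightarrow> ori y = homologous_rel_set 3 W (topspace W - {y}) C"
    using local_orientation_chain[OF W XW] by blast
  obtain n where "homologous_rel 3 W (topspace W - {X}) D (frag_cmul n C)"
    using orientation_generates[OF W XW C[OF U(2)]] collar_relcycle[OF T i vs m g] unfolding X_def D_def by blast
  moreover have "Hausdorff_space W" using W by (simp add: closed_oriented_3manifold_def closed_3manifold_def)
  ultimately obtain V where V: "openin W V" "X \<in> V"
    and DV: "\<And>y. y \<in> V \<Longrightarrow> homologous_rel 3 W (topspace W - {y}) D (frag_cmul n C)"
    using homologous_rel_nearby[OF _ XW] by metis
  \<comment> \<open>The difference \<open>D\<close> is \<open>n\<close> times the orientation near \<open>X\<close>. Where \<open>\<sigma> D\<close> is a tetrahedron of sign \<open>\<delta>\<close>,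
    this determines \<open>n\<close>.\<close>
  have deg: "\<delta> * \<sigma> * n = 1"
    if k: "k \<in> tets T" "near_face l u \<in> open_tet" and yU: "quo T (k, near_face l u) \<in> U \<inter> V"
      and o: "oriented_by W ori T k ws \<delta>"
      and h: "homologous_rel 3 W (topspace W - {quo T (k, near_face l u)}) (frag_cmul \<sigma> D) (?F k ws)"
    for k l u ws \<delta> \<sigma>
  proof -
    define y where "y = quo T (k, near_face l u)"
    let ?h = "homologous_rel 3 W (topspace W - {y})"
    have yW: "y \<in> topspace W" using inW k by (auto simp: y_def open_tet_def)
    have "ori y = homologous_rel_set 3 W (topspace W - {y}) C" using C yU y_def by auto
    moreover have "ori y = homologous_rel_set 3 W (topspace W - {y}) (frag_cmul \<delta> (?F k ws))"
      using o k unfolding oriented_by_def y_def by blast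
    ultimately have 1: "?h C (frag_cmul \<delta> (?F k ws))" using homologous_rel_set_eq by metis
    have 2: "?h (frag_cmul (\<delta> * \<sigma>) D) (frag_cmul \<delta> (?F k ws))"
      using homologous_rel_cmul[OF h, of \<delta>] by (simp add: y_def)
    have 3: "?h (frag_cmul (\<delta> * \<sigma>) D) (frag_cmul (\<delta> * \<sigma> * n) C)"
      using homologous_rel_cmul[OF DV, of y "\<delta> * \<sigma>"] yU by (simp add: y_def)
    have "?h (frag_cmul 1 C) (frag_cmul (\<delta> * \<sigma> * n) C)"
      using homologous_rel_trans[OF 3 homologous_rel_trans[OF 2[THEN homologous_rel_sym[THEN iffD1]] 1]]
      by simp
    then have "singular_relboundary 3 W (topspace W - {y}) (frag_cmul (1 - \<delta> * \<sigma> * n) C)"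
      by (simp only: homologous_rel_def frag_cmul_diff_distrib)
    then have "1 - \<delta> * \<sigma> * n = 0"
      using orientation_infinite_order[OF W yW] C yU y_def by blast
    then show ?thesis by simp
  qed
  have UV: "openin W (U \<inter> V)" using U V by blast
  obtain u where u: "0 < u" "u < 1" "quo T (i, near_face r u) \<in> U \<inter> V"
    using segment_enters_open[OF quo_continuous[OF T i] UV _ _ tet_center_in_simplex, of "face_center r"] U V fi
    unfolding X_def near_face_def open_face_def by blast
  have 1: "\<epsilon> * 1 * n = 1"
    by (rule deg[OF i near_face(1)[OF GF(1) u(1,2)] u(3) oriented_by_perm_sign[OF T i vs, folded \<epsilon>_def]])
       (use collar_cone[OF T i vs m g u(1,2)] in \<open>simp only: D_def frag_cmul_one\<close>)
  obtain u' where u': "0 < u'" "u' < 1" "quo T (j, near_face t u') \<in> U \<inter> V"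
    using segment_enters_open[OF quo_continuous[OF T GF(3)] UV _ _ tet_center_in_simplex, of "face_center t"] U V fj
    unfolding \<open>X = quo T (j, face_center t)\<close> near_face_def open_face_def by blast
  have 2: "\<epsilon>' * (-1) * n = 1"
    by (rule deg[OF GF(3) near_face(1)[OF GF(2) u'(1,2)] u'(3) oriented_by_perm_sign[OF T GF(3,4), folded \<epsilon>'_def]])
       (use collar_cone[OF T GF(3,4,5) GF(7-9) u'(1,2)] in \<open>simp only: D_def frag_cmul_minus_one minus_diff_eq\<close>)
  show ?thesis
  proof -
    have "n = 1 \<or> n = -1" using 1 zmult_eq_1_iff[of \<epsilon> n] by auto
    then show ?thesis using 1 2 by (auto simp: \<epsilon>_def \<epsilon>'_def)
  qed
qed

text \<open>The index is defined by an equation of local classes, and its value \<open>-1\<close> means that the equation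
fails. That a negative ordering does violate it relies on the orientation classes not being of order
two. The points of the simplex with reordered vertices run through the interior of the same
tetrahedron.\<close>

lemma branch_index_eq_perm_sign:
  assumes W: "closed_oriented_3manifold W ori"
    and T: "triangulation W ori T" and i: "i \<in> tets T" and b: "branching T b"
  defines "v \<equiv> bvert T b i"
  shows "branch_order T b i v" "{v 0, v 1, v 2, v 3} = {..3}"
    "branch_index W ori T b i = tor T i * perm_sign (v 0) (v 1) (v 2) (v 3)"
proof -
  have "\<exists>s. branch_order T b i s" using b i by (auto simp: branching_def)
  then show bo: "branch_order T b i v" unfolding v_def bvert_def by (rule someI_ex)
  have bij: "bij_betw v {..3} {..3}" using bo by (simp add: branch_order_def)
  have "{..3::nat} = {0,1,2,3}" by auto
  then show vs: "{v 0, v 1, v 2, v 3} = {..3}" using bij by (simp add: bij_betw_def)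
  define \<epsilon> where "\<epsilon> = tor T i * perm_sign (v 0) (v 1) (v 2) (v 3)"
  let ?F = "frag_of (affine_simplex (\<lambda>x. quo T (i, x)) (map tet_vertex [v 0, v 1, v 2, v 3]))"
  have pt: "\<exists>z\<in>open_tet. tet_simplex T i v x = quo T (i, z)" if x: "x \<in> open_tet" for x
  proof -
    let ?z = "\<lambda>u. \<Sum>j\<le>3. tet_vertex (v j) u * x j"
    have xs: "x \<in> standard_simplex 3" and xp: "\<And>j. j \<le> 3 \<Longrightarrow> 0 < x j" using x by (auto simp: open_tet_def)
    have "tet_simplex T i v x = quo T (i, ?z)"
      using xs by (simp add: tet_simplex_def simplex_map_def oriented_simplex_def)
    moreover have "?z \<in> open_tet"
    proof -
      let ?l = "map tet_vertex [v 0, v 1, v 2, v 3]"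
      have "?z = (\<lambda>u. \<Sum>j\<le>3. (?l ! j) u * x j)"
        by (intro ext sum.cong) (auto simp: le_Suc_eq eval_nat_numeral)
      then have "?z \<in> vertex_hull ?l" using xs by (auto simp: vertex_hull_def numeral_3_eq_3)
      then have "?z \<in> standard_simplex 3"
        using vertex_hull_subset_simplex[of ?l 3] four_points[OF vs] by (auto intro: tet_vertex_in_simplex)
      moreover have "0 < ?z u" if u: "u \<le> 3" for u
      proof -
        have "u \<in> v ` {..3}" using bij u by (simp add: bij_betw_def)
        then obtain j where j: "j \<le> 3" "v j = u" by auto
        have "0 < tet_vertex (v j) u * x j" using j xp by (simp add: tet_vertex_def)
        also have "\<dots> \<le> ?z u" using j xp by (intro member_le_sum) (auto simp: tet_vertex_def less_imp_le)
        finally show ?thesis .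
      qed
      ultimately show ?thesis by (simp add: open_tet_def)
    qed
    ultimately show ?thesis by blast
  qed
  have o: "ori (quo T (i, z)) = homologous_rel_set 3 W (topspace W - {quo T (i, z)}) (frag_cmul \<epsilon> ?F)"
    if "z \<in> open_tet" for z
    using oriented_by_perm_sign[OF T i vs] that unfolding oriented_by_def \<epsilon>_def by blast
  have "tor T i \<in> {1,-1}" using T i by (auto simp: triangulation_def)
  then consider "\<epsilon> = 1" | "\<epsilon> = -1"
    using perm_sign_cases[OF four_points(1)[OF vs]] by (auto simp: \<epsilon>_def)
  then have "branch_index W ori T b i = \<epsilon>"
  proof cases
    case 1
    have "local_class W (tet_simplex T i v) x = ori (tet_simplex T i v x)" if x: "x \<in> open_tet" for x
      using pt[OF x] o 1 by (auto simp: local_class_def tet_simplex_eq_affine)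
    then show ?thesis using 1 by (simp add: branch_index_def v_def)
  next
    case 2
    have x: "tet_center \<in> open_tet" using tet_center_in_simplex by (simp add: open_tet_def tet_center_def)
    obtain z where z: "z \<in> open_tet" "tet_simplex T i v tet_center = quo T (i, z)" using pt[OF x] by blast
    define y where "y = quo T (i, z)"
    have yW: "y \<in> topspace W"
      using continuous_map_image_subset_topspace[OF quo_continuous[OF T i]] z by (auto simp: y_def open_tet_def)
    have "local_class W (tet_simplex T i v) tet_center \<noteq> ori (tet_simplex T i v tet_center)"
    proof
      assume a: "local_class W (tet_simplex T i v) tet_center = ori (tet_simplex T i v tet_center)"
      have "local_class W (tet_simplex T i v) tet_center = homologous_rel_set 3 W (topspace W - {y}) ?F"
        unfolding local_class_def z(2) y_def[symmetric] unfolding tet_simplex_eq_affine ..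
      then have oF: "ori y = homologous_rel_set 3 W (topspace W - {y}) ?F" using a z(2) y_def by simp
      also have "ori y = homologous_rel_set 3 W (topspace W - {y}) (- ?F)" using o[OF z(1)] 2 by (simp add: y_def)
      finally have "homologous_rel 3 W (topspace W - {y}) ?F (- ?F)" using homologous_rel_set_eq by metis
      then have "singular_relboundary 3 W (topspace W - {y}) (frag_cmul 1 ?F + frag_cmul 1 ?F)" by (simp add: homologous_rel_def)
      then have "singular_relboundary 3 W (topspace W - {y}) (frag_cmul (1 + 1) ?F)" by (simp only: frag_cmul_distrib)
      from orientation_infinite_order[OF W yW oF this] show False by simp
    qed
    then show ?thesis using x 2 by (auto simp: branch_index_def v_def)
  qed
  then show "branch_index W ori T b i = tor T i * perm_sign (v 0) (v 1) (v 2) (v 3)" by (simp add: \<epsilon>_def)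
qed

section \<open>Moduli as cross ratios of developed vertices\<close>

lemma matrix_mul_neg:
  fixes A B :: "complex^2^2"
  shows "(- A) ** B = - (A ** B)" "A ** (- B) = - (A ** B)"
  by (simp_all add: matrix_matrix_mult_def vec_eq_iff sum_negf)

lemma PSL2C_carrierE:
  assumes "g \<in> carrier PSL2C"
  obtains A where "det A = 1" "g = {A, - A}"
  using assms that
  by (auto simp: PSL2C_def FactGroup_def RCOSETS_def r_coset_def SL2C_def matrix_mul_neg insert_commute)

lemma PSL2C_multI: "A \<in> g \<Longrightarrow> B \<in> h \<Longrightarrow> A ** B \<in> g \<otimes>\<^bsub>PSL2C\<^esub> h"
  by (auto simp: PSL2C_def FactGroup_def set_mult_def SL2C_def)

text \<open>The determinant of the vectors \<open>X(0,1)\<close>, \<open>Y(0,1)\<close>, which are homogeneous coordinates of the points \<open>X(0)\<close>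
and \<open>Y(0)\<close>. Brackets replace differences of coordinates, because a point developed from a vertex
other than \<open>v\<^sub>0\<close> may be \<open>\<infinity>\<close>.\<close>

definition zero_bracket :: "complex^2^2 \<Rightarrow> complex^2^2 \<Rightarrow> complex" where
  "zero_bracket X Y = X$1$2 * Y$2$2 - Y$1$2 * X$2$2"

lemma zero_bracket_mult: "det V = 1 \<Longrightarrow> zero_bracket (V ** X) (V ** Y) = zero_bracket X Y"
proof -
  have "zero_bracket (V ** X) (V ** Y) = det V * zero_bracket X Y"
    by (simp add: zero_bracket_def det_2 matrix_matrix_mult_def sum_2 algebra_simps)
  then show "det V = 1 \<Longrightarrow> ?thesis" by simp
qed

lemma zero_bracket_neg: "zero_bracket (- X) Y = - zero_bracket X Y" "zero_bracket X (- Y) = - zero_bracket X Y"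
  by (simp_all add: zero_bracket_def)

text \<open>With \<open>g = z([p,q])\<close> and \<open>h = z([p,x])\<close> this is the value at the point \<open>h(0)\<close> of a coordinate that is
\<open>0\<close> at \<open>0\<close> and \<open>\<infinity>\<close> at \<open>g(0)\<close>. The sign of the representative of \<open>h\<close> cancels; that of \<open>g\<close> does not,
but the choice depends on \<open>g\<close> only, so that it is the same for all \<open>x\<close>.\<close>

definition vertex_ratio :: "(complex^2^2) set \<Rightarrow> (complex^2^2) set \<Rightarrow> complex" where
  "vertex_ratio g h = (let A = SOME A. A \<in> g; X = SOME X. X \<in> h in
     zero_bracket X (mat 1) / zero_bracket X A)"

lemma psl_act_zero:
  "psl_act {A, - A} (Fin_pt 0) = (if A$2$2 = 0 then Infty else Fin_pt (A$1$2 / A$2$2))"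
  by (simp add: psl_act_def the_elem_def)

locale branched_tet =
  fixes T :: "('i, 'w) triang" and b z and i :: 'i and v
  assumes i: "i \<in> tets T" and z: "cocycle T z" and ideal: "idealizable T b z i"
    and v_def: "v = bvert T b i" and vs: "{v 0, v 1, v 2, v 3} = {..3::nat}"
begin

definition Z :: "nat \<Rightarrow> nat \<Rightarrow> (complex^2^2) set" where "Z a c = z (oedge_map T (i, v a, v c))"

definition u :: "nat \<Rightarrow> complex" where "u k = coord (upt_cp1 T b z i k)"

lemma v_le: "a \<le> 3 \<Longrightarrow> v a \<le> 3"
  using four_points(2-)[OF vs] by (auto dest: le_3_cases)

lemma v_eq:
  assumes "a \<le> 3" "c \<le> 3"
  shows "v a = v c \<longleftrightarrow> a = c"
proof -
  have "v 0 \<noteq> v 1" "v 0 \<noteq> v 2" "v 0 \<noteq> v 3" "v 1 \<noteq> v 2" "v 1 \<noteq> v 3" "v 2 \<noteq> v 3"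
    using four_points(1)[OF vs] by simp_all
  note n = this this[symmetric]
  show ?thesis using le_3_cases[OF assms(1)] le_3_cases[OF assms(2)] by (elim disjE) (simp_all add: n del: One_nat_def)
qed

lemma Z_carrier: "a \<le> 3 \<Longrightarrow> c \<le> 3 \<Longrightarrow> a \<noteq> c \<Longrightarrow> Z a c \<in> carrier PSL2C"
proof -
  assume "a \<le> 3" "c \<le> 3" "a \<noteq> c"
  then have "(i, v a, v c) \<in> abs_oedges T" using i v_le v_eq by (simp add: abs_oedges_def)
  then show ?thesis using z unfolding cocycle_def Z_def by blast
qed

lemma Z_mult:
  assumes "a \<le> 3" "c \<le> 3" "d \<le> 3" "a \<noteq> c" "c \<noteq> d" "a \<noteq> d"
  shows "Z a c \<otimes>\<^bsub>PSL2C\<^esub> Z c d = Z a d"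
proof -
  have "v a \<le> 3" "v c \<le> 3" "v d \<le> 3" "v a \<noteq> v c" "v c \<noteq> v d" "v a \<noteq> v d"
    using assms v_le v_eq by auto
  then show ?thesis using z i unfolding cocycle_def Z_def by blast
qed

text \<open>Lifting \<open>z([v\<^sub>0,v\<^sub>a])\<close> to matrices \<open>V\<^sub>a\<close> expresses the cocycle on all edges, up to sign, as
\<open>V\<^sub>a\<^sup>-\<^sup>1 V\<^sub>c\<close>.\<close>

lemma cocycle_lifts:
  obtains V where "\<And>a. a \<le> 3 \<Longrightarrow> det (V a) = 1" "\<And>a. a \<le> 3 \<Longrightarrow> V a $2$2 \<noteq> 0"
    "\<And>a. a \<le> 3 \<Longrightarrow> u a = V a $1$2 / V a $2$2"
    "\<And>a c X. a \<le> 3 \<Longrightarrow> c \<le> 3 \<Longrightarrow> a \<noteq> c \<Longrightarrow> X \<in> Z a c \<Longrightarrow> V a ** X = V c \<or> V a ** X = - V c"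
proof -
  have "\<forall>k. \<exists>A. k \<le> 3 \<and> k \<noteq> 0 \<longrightarrow> det A = 1 \<and> Z 0 k = {A, - A}"
    using PSL2C_carrierE[OF Z_carrier[of 0]] by (metis le0)
  then obtain V0 where V0: "\<And>k. k \<le> 3 \<and> k \<noteq> 0 \<Longrightarrow> det (V0 k) = 1 \<and> Z 0 k = {V0 k, - V0 k}" by metis
  define V where "V = V0(0 := mat 1)"
  have V: "det (V k) = 1" "Z 0 k = {V k, - V k}" if "k \<le> 3" "k \<noteq> 0" for k
    using V0[of k] that by (auto simp: V_def)
  have d: "det (V a) = 1" if "a \<le> 3" for a using V[OF that] by (cases "a = 0") (auto simp: V_def)
  have upt: "upt_cp1 T b z i k = psl_act (Z 0 k) (Fin_pt 0)" if "k \<le> 3" "k \<noteq> 0" for k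
  proof -
    have "k = 1 \<or> k = 2 \<or> k = 3" using that by auto
    moreover have "bcocyc T b z i a c = Z a c" for a c by (simp add: bcocyc_def Z_def flip: v_def)
    ultimately show ?thesis using Z_mult[of 0 1 2] Z_mult[of 0 2 3] by (auto simp: upt_cp1_def)
  qed
  have fin: "V a $2$2 \<noteq> 0 \<and> u a = V a $1$2 / V a $2$2" if a: "a \<le> 3" for a
  proof (cases "a = 0")
    case True
    then show ?thesis by (simp add: V_def mat_def u_def upt_cp1_def)
  next
    case False
    have "upt_cp1 T b z i a \<noteq> Infty" using ideal a by (auto simp: idealizable_def)
    then show ?thesis
      using upt[OF a False] unfolding V(2)[OF a False] psl_act_zero by (auto simp: u_def split: if_splits)
  qed
  have nz: "V a ** X = V c \<or> V a ** X = - V c" if "a \<le> 3" "c \<le> 3" "a \<noteq> c" "c \<noteq> 0" "X \<in> Z a c" for a c X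
  proof (cases "a = 0")
    case True
    then show ?thesis using that V(2)[of c] by (auto simp: V_def)
  next
    case False
    have "V a ** X \<in> Z 0 a \<otimes>\<^bsub>PSL2C\<^esub> Z a c" using that V(2)[of a] False by (intro PSL2C_multI) auto
    then have "V a ** X \<in> Z 0 c" using Z_mult[of 0 a c] that False by simp
    then show ?thesis using V(2)[of c] that by auto
  qed
  have "V a ** X = V c \<or> V a ** X = - V c" if h: "a \<le> 3" "c \<le> 3" "a \<noteq> c" "X \<in> Z a c" for a c X
  proof (cases "c = 0")
    case True
    \<comment> \<open>A third vertex \<open>t\<close> reaches \<open>z([v\<^sub>a,v\<^sub>0])\<close> by a face relation, without inverses in the group.\<close>
    obtain t :: nat where t: "t \<le> 3" "t \<noteq> 0" "t \<noteq> a"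
      by (metis One_nat_def Suc_eq_numeral le0 nle_le numeral_3_eq_3 numeral_2_eq_2 not_less_eq_eq one_le_numeral zero_neq_one zero_neq_numeral)
    have "X ** V t \<in> Z a 0 \<otimes>\<^bsub>PSL2C\<^esub> Z 0 t" using h True V(2)[of t] t by (intro PSL2C_multI) auto
    then have "X ** V t \<in> Z a t" using Z_mult[of a 0 t] h True t by simp
    then have "V a ** (X ** V t) = V t \<or> V a ** (X ** V t) = - V t" using nz[of a t] h t by auto
    then have *: "(V a ** X) ** V t = mat 1 ** V t \<or> (V a ** X) ** V t = (- mat 1) ** V t"
      by (simp add: matrix_mul_assoc matrix_mul_neg)
    have "invertible (V t)" using d[OF t(1)] by (simp add: invertible_det_nz)
    then obtain N where N: "V t ** N = mat 1" by (auto simp: invertible_def)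
    have "B = C" if "B ** V t = C ** V t" for B C :: "complex^2^2"
    proof -
      have "B ** (V t ** N) = C ** (V t ** N)" using that by (simp add: matrix_mul_assoc)
      then show ?thesis by (simp add: N)
    qed
    with * have "V a ** X = mat 1 \<or> V a ** X = - mat 1" by blast
    then show ?thesis using True by (simp add: V_def)
  next
    case False then show ?thesis using nz h by blast
  qed
  then show thesis using d fin by (intro that[of V]) auto
qed

lemma u_inj: "a \<le> 3 \<Longrightarrow> c \<le> 3 \<Longrightarrow> u a = u c \<longleftrightarrow> a = c"
proof -
  assume a: "a \<le> 3" "c \<le> 3"
  have "upt_cp1 T b z i k = Fin_pt (u k)" if "k \<le> 3" for k
    using ideal that by (cases "upt_cp1 T b z i k") (auto simp: idealizable_def u_def)
  moreover have "inj_on (upt_cp1 T b z i) {..3}" using ideal by (simp add: idealizable_def)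
  ultimately show ?thesis using a by (metis atMost_iff inj_on_eq_iff)
qed

lemma u0: "u 0 = 0" by (simp add: u_def upt_cp1_def)

definition cr :: "nat \<Rightarrow> nat \<Rightarrow> nat \<Rightarrow> nat \<Rightarrow> complex" where
  "cr a c d e = ((u e - u a) * (u d - u c)) / ((u e - u c) * (u d - u a))"

text \<open>Multiplying by \<open>V\<^sub>a\<close> changes the base vertex from \<open>v\<^sub>a\<close> to \<open>v\<^sub>0\<close> without changing brackets. The factors
that depend on the lifts of \<open>v\<^sub>a\<close> and \<open>v\<^sub>c\<close> are common to both ratios, and the cross ratio of the \<open>u\<close>'s
remains.\<close>

lemma vertex_ratio_cr:
  assumes le: "a \<le> 3" "c \<le> 3" "d \<le> 3" "e \<le> 3" and dist: "distinct [a,c,d,e]"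
  shows "vertex_ratio (Z a c) (Z a e) / vertex_ratio (Z a c) (Z a d) = cr a c d e"
    "vertex_ratio (Z a c) (Z a d) \<noteq> 0"
proof -
  obtain V where V: "\<And>a. a \<le> 3 \<Longrightarrow> det (V a) = 1" "\<And>a. a \<le> 3 \<Longrightarrow> V a $2$2 \<noteq> 0"
    "\<And>a. a \<le> 3 \<Longrightarrow> u a = V a $1$2 / V a $2$2"
    "\<And>a c X. a \<le> 3 \<Longrightarrow> c \<le> 3 \<Longrightarrow> a \<noteq> c \<Longrightarrow> X \<in> Z a c \<Longrightarrow> V a ** X = V c \<or> V a ** X = - V c"
    using cocycle_lifts by blast
  have ne: "(SOME A. A \<in> Z a c) \<in> Z a c" if "a \<le> 3" "c \<le> 3" "a \<noteq> c" for a c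
    using PSL2C_carrierE[OF Z_carrier[OF that]] by (metis insertI1 someI)
  define A where "A = (SOME A. A \<in> Z a c)"
  have br: "zero_bracket (V x) (V y) = V x $2$2 * V y $2$2 * (u x - u y)" if "x \<le> 3" "y \<le> 3" for x y
    using V(2,3)[OF that(1)] V(2,3)[OF that(2)] by (simp add: zero_bracket_def field_simps)
  have A: "V a ** A = V c \<or> V a ** A = - V c" using V(4) ne le dist by (simp add: A_def)
  obtain \<sigma> :: complex where s: "\<sigma> \<noteq> 0"
    and sA: "\<And>X. zero_bracket X (V a ** A) = \<sigma> * zero_bracket X (V c)"
  proof (cases "V a ** A = V c")
    case True then show thesis by (intro that[of 1]) auto
  next
    case False then show thesis using A by (intro that[of "-1"]) (auto simp: zero_bracket_neg)
  qed
  have r: "vertex_ratio (Z a c) (Z a x) = (V a $2$2 * (u x - u a)) / (\<sigma> * V c $2$2 * (u x - u c))"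
    if x: "x \<le> 3" "x \<noteq> a" "x \<noteq> c" for x
  proof -
    define X where "X = (SOME X. X \<in> Z a x)"
    have X: "V a ** X = V x \<or> V a ** X = - V x" using V(4) ne le x by (simp add: X_def)
    have "zero_bracket X (mat 1) = zero_bracket (V a ** X) (V a)"
      using zero_bracket_mult[OF V(1)[OF le(1)], of X "mat 1"] by simp
    moreover have "zero_bracket X A = zero_bracket (V a ** X) (V a ** A)"
      using zero_bracket_mult[OF V(1)[OF le(1)], of X A] by simp
    ultimately have "vertex_ratio (Z a c) (Z a x) = zero_bracket (V x) (V a) / (\<sigma> * zero_bracket (V x) (V c))"
      using X by (auto simp: vertex_ratio_def Let_def sA zero_bracket_neg simp flip: X_def A_def)
    also have "\<dots> = (V a $2$2 * (u x - u a)) / (\<sigma> * V c $2$2 * (u x - u c))"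
      using V(2)[OF x(1)] x le u_inj s V(2)[OF le(2)] by (simp add: br divide_simps)
    finally show ?thesis .
  qed
  show "vertex_ratio (Z a c) (Z a d) \<noteq> 0"
    using r[of d] le dist s V(2) u_inj by auto
  show "vertex_ratio (Z a c) (Z a e) / vertex_ratio (Z a c) (Z a d) = cr a c d e"
  proof -
    have "(k * x / (m * y)) / (k * x' / (m * y')) = (x * y') / (y * x')"
      if "k \<noteq> 0" "m \<noteq> 0" for k m x y x' y' :: complex
      using that by (simp add: divide_simps)
    from this[of "V a $2$2" "\<sigma> * V c $2$2"] show ?thesis
      using s V(2)[OF le(1)] V(2)[OF le(2)] le dist r[of d] r[of e] by (simp add: cr_def)
  qed
qed

lemma perm_sign_v:
  assumes "{a,c,d,e} = {..3}"
  shows "perm_sign (v a) (v c) (v d) (v e) = perm_sign a c d e * perm_sign (v 0) (v 1) (v 2) (v 3)"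
proof (rule four_points_induct[where P = "\<lambda>a c d e. perm_sign (v a) (v c) (v d) (v e) = perm_sign a c d e * perm_sign (v 0) (v 1) (v 2) (v 3)", OF _ _ _ _ assms])
  show "perm_sign (v 0) (v 1) (v 2) (v 3) = perm_sign 0 1 2 3 * perm_sign (v 0) (v 1) (v 2) (v 3)"
    by (simp add: perm_sign_def pair_sign_def)
qed (metis perm_sign_swap mult_minus_left)+

text \<open>Exchanging the endpoints of the edge, or the two other vertices, inverts both sides. This leaves one
ordering for each of the six edges, and an even one can be chosen.\<close>

lemma modulus_cr:
  assumes "{a,c,d,e} = {..3}"
  shows "edge_modulus T b z (i, {v a, v c}) powi perm_sign a c d e = cr a c d e"
proof -
  define Q where "Q a c d e \<longleftrightarrow> edge_modulus T b z (i, {v a, v c}) powi perm_sign a c d e = cr a c d e" for a c d e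
  have cr_inv: "cr c a d e = inverse (cr a c d e)" "cr a c e d = inverse (cr a c d e)" for a c d e
    by (simp_all add: cr_def mult_ac)
  have s1: "Q c a d e" if "Q a c d e" for a c d e
    using that unfolding Q_def perm_sign_swap(1)[of c a d e] power_int_minus cr_inv(1)[of c a]
    by (simp add: insert_commute)
  have s3: "Q a c e d" if "Q a c d e" for a c d e
    using that unfolding Q_def perm_sign_swap(3)[of a c e d] power_int_minus cr_inv(2)[of a c e] by simp
  have e: "Q a c d e = Q c a d e" "Q a c d e = Q a c e d" for a c d e using s1 s3 by blast+
  have un: "u 1 \<noteq> 0" "u 2 \<noteq> 0" "u 3 \<noteq> 0" "u 1 \<noteq> u 2" "u 1 \<noteq> u 3" "u 2 \<noteq> u 3"
      "u 2 \<noteq> u 1" "u 3 \<noteq> u 1" "u 3 \<noteq> u 2"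
    using u_inj[of 1 0] u_inj[of 2 0] u_inj[of 3 0] u_inj[of 1 2] u_inj[of 1 3] u_inj[of 2 3] u0 by auto
  have p: "pval T b z i 0 = u 1 * (u 3 - u 2)" "pval T b z i 1 = (u 2 - u 1) * u 3" "pval T b z i 2 = - u 2 * (u 3 - u 1)"
    by (simp_all add: pval_def u_def)
  have m3: "(1 + 2) mod 3 = (0::nat)" "(2 + 1) mod 3 = (0::nat)" "(2 + 2) mod 3 = (1::nat)" "(1 + 1) mod 3 = (2::nat)"
     "(0 + 1) mod 3 = (1::nat)" "(0 + 2) mod 3 = (2::nat)" by simp_all
  have w: "wval T b z i 0 = ((u 2 - u 1) * u 3) / (u 2 * (u 3 - u 1))"
     "wval T b z i 1 = (u 2 * (u 3 - u 1)) / (u 1 * (u 3 - u 2))"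
     "wval T b z i 2 = - (u 1 * (u 3 - u 2)) / ((u 2 - u 1) * u 3)"
    unfolding wval_def m3 p by simp_all
  have vv: "v 0 \<noteq> v 1" "v 0 \<noteq> v 2" "v 0 \<noteq> v 3" "v 1 \<noteq> v 2" "v 1 \<noteq> v 3" "v 2 \<noteq> v 3"
    by (simp_all add: v_eq)
  have em: "edge_modulus T b z (i, {v 0, v 1}) = wval T b z i 0" "edge_modulus T b z (i, {v 2, v 3}) = wval T b z i 0"
    "edge_modulus T b z (i, {v 1, v 2}) = wval T b z i 1" "edge_modulus T b z (i, {v 0, v 3}) = wval T b z i 1"
    "edge_modulus T b z (i, {v 0, v 2}) = wval T b z i 2" "edge_modulus T b z (i, {v 1, v 3}) = wval T b z i 2"
    unfolding edge_modulus_def Let_def v_def[symmetric] fst_conv snd_conv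
    by (simp_all add: doubleton_eq_iff vv vv[symmetric] del: One_nat_def)
  have ps: "perm_sign 0 1 2 3 = 1" "perm_sign 2 3 0 1 = 1" "perm_sign 1 2 0 3 = 1" "perm_sign 0 3 1 2 = 1"
    "perm_sign 0 2 3 1 = 1" "perm_sign 1 3 2 0 = 1" by (simp_all add: perm_sign_def pair_sign_def)
  have Qs: "Q 0 1 2 3" "Q 2 3 0 1" "Q 1 2 0 3" "Q 0 3 1 2" "Q 0 2 3 1" "Q 1 3 2 0"
    unfolding Q_def em ps power_int_1_right w cr_def u0 using un by (simp_all add: divide_simps; simp add: algebra_simps)+
  note D = four_points[OF assms]
  have "Q a c d e"
    using le_3_cases[OF D(2)] le_3_cases[OF D(3)] le_3_cases[OF D(4)] le_3_cases[OF D(5)] D(1) Qs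
    by (elim disjE; simp del: One_nat_def; simp only: e)
  then show ?thesis by (simp add: Q_def)
qed

lemma modulus_vertex_ratio:
  assumes pq: "{p,q,r,s} = {..3}" and sg: "\<tau> * perm_sign p q r s = 1"
    and \<beta>: "\<beta> = \<tau> * perm_sign (v 0) (v 1) (v 2) (v 3)"
  defines "f \<equiv> \<lambda>x. vertex_ratio (z (oedge_map T (i, p, q))) (z (oedge_map T (i, p, x)))"
  shows "edge_modulus T b z (i, {p, q}) powi \<beta> = f s / f r" "f r \<noteq> 0"
proof -
  have e4: "{..3::nat} = {0,1,2,3}" by auto
  have "v ` {..3} = {..3}" using vs unfolding e4 by simp
  then have "\<exists>a\<le>3. x = v a" if "x \<le> 3" for x using that by (metis atMost_iff imageE)
  then obtain a c d e where le: "a \<le> 3" "c \<le> 3" "d \<le> 3" "e \<le> 3" and eq: "p = v a" "q = v c" "r = v d" "s = v e"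
    using four_points[OF pq] by metis
  have dist: "distinct [a,c,d,e]" using four_points(1)[OF pq] eq by auto
  then have acde: "{a,c,d,e} = {..3}"
    using le by (intro card_subset_eq) auto
  have "perm_sign p q r s * perm_sign p q r s = 1" using perm_sign_cases[OF four_points(1)[OF pq]] by auto
  moreover have "\<tau> = perm_sign p q r s" using sg by (metis mult.commute mult.left_commute mult.right_neutral calculation)
  moreover have "perm_sign p q r s * perm_sign (v 0) (v 1) (v 2) (v 3) = perm_sign a c d e"
    using perm_sign_v[OF acde] perm_sign_cases[OF four_points(1)[OF vs]] eq by auto
  ultimately have "\<beta> = perm_sign a c d e" using \<beta> by simp
  then show "edge_modulus T b z (i, {p, q}) powi \<beta> = f s / f r" "f r \<noteq> 0"
    using modulus_cr[OF acde] vertex_ratio_cr[OF le dist] by (simp_all add: f_def eq Z_def)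
qed

end

section \<open>Turning around an edge\<close>

lemma edge_map_eq_iff: "edge_map T a = edge_map T c \<longleftrightarrow> equivclp (edge_id T) a c"
proof -
  have "equivclp (edge_id T) a c \<longleftrightarrow> equivclp (edge_id T) a = equivclp (edge_id T) c"
    using equivp_evquivclp[of "edge_id T"] unfolding equivp_def by blast
  then show ?thesis unfolding edge_map_def by (simp add: set_eq_iff fun_eq_iff)
qed

lemma oedge_map_eq_iff: "oedge_map T a = oedge_map T c \<longleftrightarrow> equivclp (oedge_id T) a c"
proof -
  have "equivclp (oedge_id T) a c \<longleftrightarrow> equivclp (oedge_id T) a = equivclp (oedge_id T) c"
    using equivp_evquivclp[of "oedge_id T"] unfolding equivp_def by blast
  then show ?thesis unfolding oedge_map_def by (simp add: set_eq_iff fun_eq_iff)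
qed

lemma oedge_glue:
  assumes "i \<in> tets T" "u \<le> 3" "v \<le> 3" "u \<noteq> v" "r \<le> 3" "r \<noteq> u" "r \<noteq> v" "mate T (i, r) = (j, t)"
  shows "oedge_map T (j, glue T (i, r) u, glue T (i, r) v) = oedge_map T (i, u, v)"
proof -
  have "oedge_id T (i, u, v) (j, glue T (i, r) u, glue T (i, r) v)"
    using assms by (auto simp: oedge_id_def abs_oedges_def intro!: exI[of _ r])
  then show ?thesis unfolding oedge_map_eq_iff by (meson r_into_equivclp equivclp_sym)
qed

text \<open>The identifications of edges respect their endpoints, so an orientation can be carried along a chain
of identifications.\<close>

lemma edge_equiv_lift:
  assumes fp: "face_pairing T" and uv: "(i, u, v) \<in> abs_oedges T" and e: "equivclp (edge_id T) (i, {u, v}) c"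
  shows "\<exists>j u' v'. c = (j, {u', v'}) \<and> (j, u', v') \<in> abs_oedges T \<and> equivclp (oedge_id T) (i, u, v) (j, u', v')"
  using e
proof (induction rule: equivclp_induct)
  case base
  show ?case using uv by (intro exI[of _ i] exI[of _ u] exI[of _ v]) simp
next
  case (step y w)
  then obtain j u' v' where y: "y = (j, {u', v'})" "(j, u', v') \<in> abs_oedges T" "equivclp (oedge_id T) (i, u, v) (j, u', v')"
    by blast
  from step(2) show ?case
  proof
    assume "edge_id T y w"
    then obtain k where k: "k \<le> 3" "k \<noteq> u'" "k \<noteq> v'" "w = (fst (mate T (j, k)), {glue T (j, k) u', glue T (j, k) v'})"
      using y by (auto simp: edge_id_def)
    obtain l t where lt: "mate T (j, k) = (l, t)" by fastforce
    have j: "j \<in> tets T" "u' \<le> 3" "v' \<le> 3" "u' \<noteq> v'" using y(2) by (auto simp: abs_oedges_def)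
    note D = face_pairingD[OF fp j(1) k(1) lt]
    have "(l, glue T (j, k) u', glue T (j, k) v') \<in> abs_oedges T"
      using D(1) D(8)[of u'] D(8)[of v'] D(6)[of u'] D(6)[of v'] j k by (auto simp: abs_oedges_def)
    moreover have "oedge_id T (j, u', v') (l, glue T (j, k) u', glue T (j, k) v')"
      using y(2) k lt by (auto simp: oedge_id_def)
    ultimately show ?thesis using y(3) k(4) lt equivclp_into_equivclp by (metis fst_conv)
  next
    assume h: "edge_id T w y"
    then obtain l x x' where w: "w = (l, {x, x'})" "l \<in> tets T" "x \<le> 3" "x' \<le> 3" "x \<noteq> x'"
      by (auto simp: edge_id_def abs_edges_def)
    obtain k where k: "k \<le> 3" "k \<noteq> x" "k \<noteq> x'" "j = fst (mate T (l, k))"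
      "{u', v'} = {glue T (l, k) x, glue T (l, k) x'}"
      using h w y(1) by (auto simp: edge_id_def)
    have "\<exists>a a'. {a, a'} = {x, x'} \<and> u' = glue T (l, k) a \<and> v' = glue T (l, k) a'"
      using k(5) by (auto simp: doubleton_eq_iff)
    then obtain a a' where a: "{a, a'} = {x, x'}" "u' = glue T (l, k) a" "v' = glue T (l, k) a'" by blast
    then have aa: "a \<le> 3" "a' \<le> 3" "a \<noteq> a'" "k \<noteq> a" "k \<noteq> a'" using w k by (auto simp: doubleton_eq_iff)
    have "(l, a, a') \<in> abs_oedges T" using aa w by (auto simp: abs_oedges_def)
    moreover then have "oedge_id T (l, a, a') (j, u', v')"
      using aa a k by (auto simp: oedge_id_def)
    ultimately have "equivclp (oedge_id T) (i, u, v) (l, a, a')"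
      using y(3) by (meson equivclp_into_equivclp)
    with \<open>(l, a, a') \<in> abs_oedges T\<close> show ?thesis using a(1) w(1) by metis
  qed
qed

lemma oedge_equiv_edge_equiv:
  assumes "equivclp (oedge_id T) a c"
  shows "equivclp (edge_id T) (fst a, {fst (snd a), snd (snd a)}) (fst c, {fst (snd c), snd (snd c)})"
proof -
  have *: "edge_id T (fst x, {fst (snd x), snd (snd x)}) (fst y, {fst (snd y), snd (snd y)})"
    if "oedge_id T x y" for x y
  proof -
    obtain i u v k where x: "x = (i, u, v)" "i \<in> tets T" "u \<le> 3" "v \<le> 3" "u \<noteq> v" "k \<le> 3" "k \<noteq> u" "k \<noteq> v"
      "y = (fst (mate T (i, k)), glue T (i, k) u, glue T (i, k) v)"
    proof -
      obtain i u v k where "x \<in> abs_oedges T" "x = (i, u, v)" "k \<le> 3" "k \<noteq> u" "k \<noteq> v"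
        "y = (fst (mate T (i, k)), glue T (i, k) u, glue T (i, k) v)"
        using \<open>oedge_id T x y\<close> unfolding oedge_id_def by blast
      then show thesis by (intro that[of i u v k]) (auto simp: abs_oedges_def)
    qed
    have "(i, {u, v}) \<in> abs_edges T" unfolding abs_edges_def using x by blast
    moreover have "glue T (i, k) ` {u, v} = {glue T (i, k) u, glue T (i, k) v}" by simp
    ultimately show ?thesis unfolding edge_id_def x(1,9) fst_conv snd_conv
      using x(6-8) by (intro conjI exI[of _ k]) auto
  qed
  from assms show ?thesis
  proof (induction rule: equivclp_induct)
    case base show ?case by simp
  next
    case (step y w)
    have "edge_id T (fst y, {fst (snd y), snd (snd y)}) (fst w, {fst (snd w), snd (snd w)}) \<or>
        edge_id T (fst w, {fst (snd w), snd (snd w)}) (fst y, {fst (snd y), snd (snd y)})"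
      using step(2) *[of y w] *[of w y] by blast
    with step(3) show ?case by (rule equivclp_into_equivclp)
  qed
qed

theorem lemma2p12:
  fixes W :: "'w topology"
    and ori :: "'w \<Rightarrow> 'w chain set"
    and \<rho> :: "('p, 'w, (complex^2^2) set) gbundle"
    and T :: "('i, 'w) triang"
    and b :: "('i \<times> nat \<times> nat) set set"
    and w :: "'i \<times> nat set \<Rightarrow> complex"
    and e :: "('i \<times> nat set) set"
  assumes "closed_oriented_3manifold W ori"
    and "flat_principal_bundle PSL2C W \<rho>"
    and "I_triangulation W ori \<rho> T b w"
    and "e \<in> edges T"
  shows "(\<Prod>a\<in>{a \<in> abs_edges T. edge_map T a = e}.
            w a powi branch_index W ori T b (fst a)) = 1"
proof -
  note W = assms(1)
  obtain z where T: "triangulation W ori T" and b: "branching T b" and z: "cocycle T z"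
    and ideal: "\<And>i. i \<in> tets T \<Longrightarrow> idealizable T b z i"
    and w: "\<And>a. a \<in> abs_edges T \<Longrightarrow> w a = edge_modulus T b z a"
    using assms(3) by (auto simp: I_triangulation_def D_triangulation_def)
  have fp: "face_pairing T" and fin: "finite (tets T)" using T by (auto simp: triangulation_def)
  obtain i0 u0 v0 where o0: "(i0, u0, v0) \<in> abs_oedges T" and e: "e = edge_map T (i0, {u0, v0})"
    using assms(4) by (auto simp: edges_def abs_edges_def abs_oedges_def)
  define oc where "oc = oedge_map T (i0, u0, v0)"
  \<comment> \<open>The abstract edges over \<open>e\<close>, directed like \<open>[u0,v0]\<close> and completed to a positive ordering of the
    vertices of their tetrahedron.\<close>
  define F where "F = {(i, p, q, r, s). i \<in> tets T \<and> {p, q, r, s} = {..3} \<and>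
      tor T i * perm_sign p q r s = 1 \<and> oedge_map T (i, p, q) = oc}"
  define E where "E = {a \<in> abs_edges T. edge_map T a = e}"
  define edge where "edge = (\<lambda>(i::'i, p::nat, q::nat, r::nat, s::nat). (i, {p, q}))"
  define \<phi>r where "\<phi>r = (\<lambda>(i, p, q, r::nat, s::nat). vertex_ratio (z (oedge_map T (i, p, q))) (z (oedge_map T (i, p, r))))"
  define \<phi>s where "\<phi>s = (\<lambda>(i, p, q, r::nat, s). vertex_ratio (z (oedge_map T (i, p, q))) (z (oedge_map T (i, p, s))))"
  \<comment> \<open>Cross the face \<open>pqs\<close>, which is opposite to \<open>r\<close>: the vertex \<open>s\<close> becomes the new \<open>r\<close>, and the vertex \<open>t\<close>
    opposite to the face on the other side becomes the new \<open>s\<close>.\<close>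
  define turn where "turn = (\<lambda>(i, p, q, r, s). let g = glue T (i, r); (j, t) = mate T (i, r) in (j, g p, g q, g s, t))"
  define unturn where "unturn = (\<lambda>(j, p', q', s', t). let g = glue T (j, t); (i, r) = mate T (j, t) in (i, g p', g q', r, g s'))"
  have "F \<subseteq> tets T \<times> {..3} \<times> {..3} \<times> {..3} \<times> {..3}"
    by (clarsimp simp: F_def four_points(2-))
  then have finF: "finite F" by (rule finite_subset) (simp add: fin)

  have "inj_on edge F"
  proof (rule inj_onI, clarsimp simp: F_def edge_def)
    fix i p q r s p' q' r' s'
    assume i: "i \<in> tets T" and pq: "{p, q, r, s} = {..3}" "{p', q', r', s'} = {..3}"
      and sg: "tor T i * perm_sign p q r s = 1" "tor T i * perm_sign p' q' r' s' = 1"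
      and oe: "oc = oedge_map T (i, p, q)" "oedge_map T (i, p', q') = oedge_map T (i, p, q)" and eq: "{p, q} = {p', q'}"
    note D = four_points[OF pq(1)] and D' = four_points[OF pq(2)]
    have "oedge_map T (i, p, q) \<noteq> oedge_map T (i, q, p)"
    proof -
      have "(i, p, q) \<in> abs_oedges T" using i D by (simp add: abs_oedges_def)
      then show ?thesis using b unfolding branching_def by auto
    qed
    then have 1: "p' = p" "q' = q" using eq oe by (auto simp: doubleton_eq_iff)
    have "{r, s} = {..3} - {p, q}" "{r', s'} = {..3} - {p, q}" using pq D(1) D'(1) 1 by auto
    then have "r' = r \<and> s' = s \<or> r' = s \<and> s' = r" by (metis doubleton_eq_iff)
    moreover have "\<not> (r' = s \<and> s' = r)" using sg 1 perm_sign_swap(3)[of p q s r] by auto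
    ultimately show "p = p' \<and> q = q' \<and> r = r' \<and> s = s'" using 1 by auto
  qed
  moreover have "edge ` F = E"
  proof (intro equalityI subsetI)
    fix a assume "a \<in> edge ` F"
    then obtain i p q r s where f: "(i, p, q, r, s) \<in> F" "a = (i, {p, q})" by (auto simp: edge_def)
    have f': "i \<in> tets T" "{p, q, r, s} = {..3}" "oedge_map T (i, p, q) = oc" using f(1) by (auto simp: F_def)
    note D = four_points[OF f'(2)]
    have "equivclp (edge_id T) (i, {p, q}) (i0, {u0, v0})"
      using oedge_equiv_edge_equiv[of T "(i, p, q)" "(i0, u0, v0)"] f'(3) by (simp add: oc_def oedge_map_eq_iff)
    then show "a \<in> E" using D f' f by (auto simp: E_def abs_edges_def e edge_map_eq_iff)
  next
    fix a assume a: "a \<in> E"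
    then have "equivclp (edge_id T) (i0, {u0, v0}) a" by (metis (mono_tags, lifting) E_def e edge_map_eq_iff mem_Collect_eq)
    then obtain j p q where j: "a = (j, {p, q})" "(j, p, q) \<in> abs_oedges T" "oedge_map T (j, p, q) = oc"
      using edge_equiv_lift[OF fp o0] unfolding oc_def oedge_map_eq_iff by (metis equivclp_sym)
    have pq: "j \<in> tets T" "p \<le> 3" "q \<le> 3" "p \<noteq> q" using j by (auto simp: abs_oedges_def)
    have "card ({..3} - {p, q}) = 2" using pq by (simp add: card_Diff_subset)
    then obtain r s where "{..3} - {p, q} = {r, s}" by (auto simp: card_2_iff)
    then have rs: "{p, q, r, s} = {..3}" "{p, q, s, r} = {..3}" using pq by auto
    have "tor T j \<in> {1, -1}" using T pq by (auto simp: triangulation_def)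
    then have "tor T j * perm_sign p q r s = 1 \<or> tor T j * perm_sign p q s r = 1"
      using perm_sign_cases[OF four_points(1)[OF rs(1)]] perm_sign_swap(3)[of p q s r] by auto
    then have "(j, p, q, r, s) \<in> F \<or> (j, p, q, s, r) \<in> F" using rs pq j by (auto simp: F_def)
    then show "a \<in> edge ` F" using j by (force simp: edge_def)
  qed
  ultimately have edge: "bij_betw edge F E" by (simp add: bij_betw_def)

  have factor: "w (edge f) powi branch_index W ori T b (fst (edge f)) = \<phi>s f / \<phi>r f" "\<phi>r f \<noteq> 0" if fF: "f \<in> F" for f
  proof -
    obtain i p q r s where f: "f = (i, p, q, r, s)" by (metis prod_cases5)
    have f': "i \<in> tets T" "{p, q, r, s} = {..3}" "tor T i * perm_sign p q r s = 1" using fF by (auto simp: F_def f)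
    interpret branched_tet T b z i "bvert T b i"
      using f' z ideal branch_index_eq_perm_sign[OF W T f'(1) b] by unfold_locales auto
    have "(i, {p, q}) \<in> abs_edges T" using f' four_points[OF f'(2)] by (auto simp: abs_edges_def)
    then show "w (edge f) powi branch_index W ori T b (fst (edge f)) = \<phi>s f / \<phi>r f" "\<phi>r f \<noteq> 0"
      using modulus_vertex_ratio[OF f'(2,3) branch_index_eq_perm_sign(3)[OF W T f'(1) b]] w
      by (simp_all add: f edge_def \<phi>s_def \<phi>r_def)
  qed

  have turn: "turn f \<in> F \<and> \<phi>r (turn f) = \<phi>s f \<and>
     unturn (turn f) = f" if fF: "f \<in> F" for f
  proof -
    obtain i p q r s where f: "f = (i, p, q, r, s)" by (metis prod_cases5)
    have i: "i \<in> tets T" and pq: "{p, q, r, s} = {..3}" and sg: "tor T i * perm_sign p q r s = 1"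
      and oe: "oedge_map T (i, p, q) = oc" using fF by (auto simp: F_def f)
    have pq': "{p, q, s, r} = {..3}" using pq by (simp add: insert_commute)
    obtain j t where m: "mate T (i, r) = (j, t)" by fastforce
    note G = glued_face[OF T i pq' m refl refl refl]
    note D = four_points[OF pq']
    have tf: "turn f = (j, glue T (i, r) p, glue T (i, r) q, glue T (i, r) s, t)" by (simp add: turn_def f m Let_def)
    have o1: "oedge_map T (j, glue T (i, r) p, glue T (i, r) q) = oedge_map T (i, p, q)"
      by (rule oedge_glue[OF i _ _ _ _ _ _ m]; use D in auto)+
    have o2: "oedge_map T (j, glue T (i, r) p, glue T (i, r) s) = oedge_map T (i, p, s)"
      by (rule oedge_glue[OF i _ _ _ _ _ _ m]; use D in auto)+
    have "tor T j * perm_sign (glue T (i, r) p) (glue T (i, r) q) (glue T (i, r) s) t = 1"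
      using gluing_reverses_orientation[OF W T i pq' m refl refl refl] sg perm_sign_swap(3)[of p q s r] by simp
    then have "turn f \<in> F" unfolding tf using G oe o1 by (simp add: F_def)
    moreover have "unturn (turn f) = f"
      unfolding tf by (simp add: f unturn_def G(5) Let_def flip: G(7,8,9))
    moreover have "\<phi>r (turn f) = \<phi>s f" unfolding tf by (simp add: f \<phi>r_def \<phi>s_def o1 o2)
    ultimately show ?thesis by blast
  qed
  have "inj_on turn F" using turn by (intro inj_on_inverseI[where g = unturn]) blast
  moreover from this have "turn ` F = F" using turn finF by (intro endo_inj_surj) auto
  ultimately have turn_bij: "bij_betw turn F F" by (simp add: bij_betw_def)
  have "(\<Prod>a\<in>E. w a powi branch_index W ori T b (fst a)) = (\<Prod>f\<in>F. \<phi>s f / \<phi>r f)"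
    using factor by (simp flip: prod.reindex_bij_betw[OF edge])
  also have "\<dots> = (\<Prod>f\<in>F. \<phi>r (turn f)) / (\<Prod>f\<in>F. \<phi>r f)"
    using turn by (simp add: prod_dividef)
  also have "\<dots> = 1"
    using factor(2) finF by (simp add: prod.reindex_bij_betw[OF turn_bij])
  finally show ?thesis by (simp add: E_def)
qed

end
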